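(* Let $a<b$ be real numbers, $n\ge 1$ an integer, $0<d<\pi/2$, $0<\alpha\le 1$, and $\mathbf{r}\in\mathbb{C}^n$. Let $K=[k_{ij}]$ be an $n\times n$ matrix of functions and $\mathbf{g}=[g_1,\ldots,g_n]^{\mathrm T}$ a vector of functions, and put $Q(z)=(z-a)(b-z)$. Assume that $k_{ij}Q\in \mathbf{L}_{\alpha}(\psi^{\mathrm{DE}}(\mathscr{D}_d))$ for all $i,j=1,\ldots,n$ and $g_iQ\in \mathbf{L}_{\alpha}(\psi^{\mathrm{DE}}(\mathscr{D}_d))$ for all $i=1,\ldots,n$. Then the initial value problem $$\mathbf{y}'(t)=K(t)\mathbf{y}(t)+\mathbf{g}(t)\quad(a\le t\le b),\qquad \mathbf{y}(a)=\mathbf{r},$$ has a unique solution $\mathbf{y}=[y_1,\ldots,y_n]^{\mathrm T}$, and $y_i\in\mathbf{M}_{\alpha}(\psi^{\mathrm{DE}}(\mathscr{D}_d))$ for $i=1,\ldots,n$.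
   Context: $\mathscr{D}_d=\{\zeta\in\mathbb{C}:|\operatorname{Im}\zeta|<d\}$, $\psi^{\mathrm{DE}}(\zeta)=\frac{b-a}{2}\tanh\left(\frac{\pi}{2}\sinh\zeta\right)+\frac{b+a}{2}$, and $\mathscr{D}=\psi^{\mathrm{DE}}(\mathscr{D}_d)=\{\psi^{\mathrm{DE}}(\zeta):\zeta\in\mathscr{D}_d\}$, regarded as a Riemann surface (since $\psi^{\mathrm{DE}}$ is not injective on $\mathscr{D}_d$). Concretely, a function $f$ on $\mathscr{D}$ is identified with the function $F$ on $\mathscr{D}_d$, written $F(\zeta)=f(\psi^{\mathrm{DE}}(\zeta))$, and is called analytic if $F$ is analytic; in inequalities "for all $z\in\mathscr{D}$", $f(z)$ means $F(\zeta)$ and $z$ means $\psi^{\mathrm{DE}}(\zeta)$, for all $\zeta\in\mathscr{D}_d$. The interval $(a,b)$ corresponds to $\zeta\in\mathbb{R}$, and $a$, $b$ correspond to $\operatorname{Re}\zeta\to-\infty$, $+\infty$. $\mathbf{H}^{\infty}(\mathscr{D})$ is the set of functions $f$ analytic on $\mathscr{D}$ with $\sup_{z\in\mathscr{D}}|f(z)|<\infty$. For $\alpha>0$, $\mathbf{L}_{\alpha}(\mathscr{D})$ is the set of $f\in\mathbf{H}^{\infty}(\mathscr{D})$ for which there is a constant $L$ with $|f(z)|\le L|Q(z)|^{\alpha}$ for all $z\in\mathscr{D}$, where $Q(z)=(z-a)(b-z)$. For $0<\alpha\le1$, $\mathbf{M}_{\alpha}(\mathscr{D})$ is the set of $f\in\mathbf{H}^{\infty}(\mathscr{D})$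 for which there is a constant $M$ with $|f(z)-f(a)|\le M|z-a|^{\alpha}$ and $|f(b)-f(z)|\le M|b-z|^{\alpha}$ for all $z\in\mathscr{D}$ (here $f(a),f(b)$ are the boundary values of $f$ at $a$ and $b$). The functions $k_{ij},g_i$ may be singular (but integrable) at $a$ and $b$; the initial value problem is understood in its equivalent integrated form $\mathbf{y}(t)=\mathbf{r}+\int_a^t\{\mathbf{g}(s)+K(s)\mathbf{y}(s)\}\,ds$, $a\le t\le b$, for $\mathbf{y}$ continuous on $[a,b]$. A function on $[a,b]$ is said to belong to $\mathbf{M}_\alpha(\mathscr{D})$ if it extends analytically to such a function. *)

theory Defs
  imports "HOL-Analysis.Analysis"
begin

definition strip :: "real \<Rightarrow> complex set" where
  "strip d = {\<zeta>. \<bar>Im \<zeta>\<bar> < d}"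

definition psi_DE :: "real \<Rightarrow> real \<Rightarrow> complex \<Rightarrow> complex" where
  "psi_DE a b \<zeta> =
     of_real ((b - a) / 2) * tanh (of_real (pi / 2) * sinh \<zeta>) + of_real ((b + a) / 2)"

definition Q :: "real \<Rightarrow> real \<Rightarrow> complex \<Rightarrow> complex" where
  "Q a b z = (z - of_real a) * (of_real b - z)"

text \<open>
  The map \<^const>\<open>psi_DE\<close> is not injective on the strip, and the image of the strip is regarded as
  a Riemann surface. A function \<open>f\<close> on this surface is represented by its pullback
  \<open>F \<zeta> = f (psi_DE a b \<zeta>)\<close>, a function on the strip. The spaces below are therefore sets of
  such pullbacks, and the point of the plane under \<open>\<zeta>\<close> is \<open>psi_DE a b \<zeta>\<close>. Values of \<open>F\<close> outside
  the strip play no role.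
\<close>

definition H_inf :: "real \<Rightarrow> (complex \<Rightarrow> complex) set" where
  "H_inf d = {F. F analytic_on strip d \<and> bounded (F ` strip d)}"

definition L_space :: "real \<Rightarrow> real \<Rightarrow> real \<Rightarrow> real \<Rightarrow> (complex \<Rightarrow> complex) set" where
  "L_space a b d \<alpha> =
     {F \<in> H_inf d. \<exists>L. \<forall>\<zeta>\<in>strip d. norm (F \<zeta>) \<le> L * norm (Q a b (psi_DE a b \<zeta>)) powr \<alpha>}"

text \<open>
  The end points \<open>a\<close> and \<open>b\<close> correspond to \<open>Re \<zeta> \<longrightarrow> -\<infinity>\<close> and \<open>Re \<zeta> \<longrightarrow> \<infinity>\<close> inside the strip.
  Boundary values of a function on the surface are limits along these two filters.
\<close>

definition left_end :: "real \<Rightarrow> complex filter" where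
  "left_end d = inf (filtercomap Re at_bot) (principal (strip d))"

definition right_end :: "real \<Rightarrow> complex filter" where
  "right_end d = inf (filtercomap Re at_top) (principal (strip d))"

definition M_space :: "real \<Rightarrow> real \<Rightarrow> real \<Rightarrow> real \<Rightarrow> (complex \<Rightarrow> complex) set" where
  "M_space a b d \<alpha> =
     {F \<in> H_inf d. \<exists>fa fb M.
        (F \<longlongrightarrow> fa) (left_end d) \<and> (F \<longlongrightarrow> fb) (right_end d) \<and>
        (\<forall>\<zeta>\<in>strip d.
           norm (F \<zeta> - fa) \<le> M * norm (psi_DE a b \<zeta> - of_real a) powr \<alpha> \<and>
           norm (fb - F \<zeta>) \<le> M * norm (of_real b - psi_DE a b \<zeta>) powr \<alpha>)}"

text \<open>
  On the real line \<^const>\<open>psi_DE\<close> is a bijection onto the open interval from \<open>a\<close> to \<open>b\<close>, so a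
  function on the surface has a value at each real \<open>t\<close> strictly between \<open>a\<close> and \<open>b\<close>, namely the
  one at the real preimage of \<open>t\<close>. At \<open>t = a\<close> and \<open>t = b\<close> the value of \<open>on_interval\<close> is
  unspecified; it is only used below an integral sign or for \<open>t\<close> in the open interval.
\<close>

lemma tanh_artanh_real:
  fixes u :: real
  assumes "\<bar>u\<bar> < 1"
  shows "tanh (artanh u) = u"
proof -
  have e: "exp (- (2 * artanh u)) = (1 - u) / (1 + u)"
    using assms by (simp add: artanh_def exp_minus)
  have "tanh (artanh u) = (1 - (1 - u) / (1 + u)) / (1 + (1 - u) / (1 + u))"
    unfolding tanh_real_altdef using e by simp
  also have "\<dots> = u" using assms by (simp add: field_simps)
  finally show ?thesis .
qed

lemma psi_DE_of_real:
  "psi_DE a b (of_real x) = of_real ((b - a) / 2 * tanh (pi / 2 * sinh x) + (b + a) / 2)"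
proof -
  have s: "sinh (of_real x) = (of_real (sinh x) :: complex)" for x :: real
    by (simp add: sinh_def scaleR_conv_of_real exp_of_real flip: of_real_minus)
  have c: "cosh (of_real x) = (of_real (cosh x) :: complex)" for x :: real
    by (simp add: cosh_def scaleR_conv_of_real exp_of_real flip: of_real_minus)
  have t: "tanh (of_real x) = (of_real (tanh x) :: complex)" for x :: real
    by (simp add: tanh_def s c)
  have "tanh (of_real (pi / 2) * sinh (of_real x)) = (of_real (tanh (pi / 2 * sinh x)) :: complex)"
    by (simp only: s t flip: of_real_mult)
  then show ?thesis by (simp only: psi_DE_def of_real_add of_real_mult)
qed

lemma psi_DE_ex1:
  fixes a b t :: real
  assumes "a < t" and "t < b"
  shows "\<exists>!x::real. psi_DE a b (of_real x) = of_real t"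
proof -
  define u where "u = (2 * t - a - b) / (b - a)"
  have ab: "b - a > 0" using assms by simp
  have u: "\<bar>u\<bar> < 1" using assms by (simp add: u_def abs_if field_simps)
  have 1: "psi_DE a b (of_real x) = of_real t \<longleftrightarrow> tanh (pi / 2 * sinh x) = u" for x :: real
    unfolding psi_DE_of_real of_real_eq_iff using ab by (auto simp: u_def field_simps)
  have 2: "tanh (pi / 2 * sinh x) = u \<longleftrightarrow> x = arsinh (2 / pi * artanh u)" for x :: real
  proof
    assume "tanh (pi / 2 * sinh x) = u"
    then have "artanh u = pi / 2 * sinh x" using artanh_tanh_real by blast
    then have "2 / pi * artanh u = sinh x" by (simp add: field_simps)
    then show "x = arsinh (2 / pi * artanh u)" by (metis arsinh_sinh_real)
  qed (simp add: sinh_arsinh_real tanh_artanh_real u)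
  show ?thesis unfolding 1 2 by simp
qed

definition on_interval :: "real \<Rightarrow> real \<Rightarrow> (complex \<Rightarrow> 'a) \<Rightarrow> real \<Rightarrow> 'a" where
  "on_interval a b F t = F (of_real (THE x::real. psi_DE a b (of_real x) = of_real t))"

definition interval_M_space :: "real \<Rightarrow> real \<Rightarrow> real \<Rightarrow> real \<Rightarrow> (real \<Rightarrow> complex) set" where
  "interval_M_space a b d \<alpha> =
     {f. \<exists>F\<in>M_space a b d \<alpha>.
        (\<forall>t\<in>{a<..<b}. on_interval a b F t = f t) \<and>
        (F \<longlongrightarrow> f a) (left_end d) \<and> (F \<longlongrightarrow> f b) (right_end d)}"

text \<open>
  The coefficients may be singular at the end points, so the initial value problem is stated in
  integrated form. The coefficients \<open>K\<close> and \<open>g\<close> are functions on the surface, and the unknown \<open>y\<close>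
  is a function on the closed interval.
\<close>

definition ivp_solution ::
  "real \<Rightarrow> real \<Rightarrow> (complex \<Rightarrow> complex^'n^'n) \<Rightarrow> (complex \<Rightarrow> complex^'n) \<Rightarrow> complex^'n
     \<Rightarrow> (real \<Rightarrow> complex^'n) \<Rightarrow> bool" where
  "ivp_solution a b K g r y \<longleftrightarrow>
     continuous_on {a..b} y \<and>
     (\<lambda>s. on_interval a b g s + on_interval a b K s *v y s) absolutely_integrable_on {a..b} \<and>
     (\<forall>t\<in>{a..b}.
        y t = r + integral {a..t} (\<lambda>s. on_interval a b g s + on_interval a b K s *v y s))"

end

theory Submission
  imports Defs "HOL-Complex_Analysis.Cauchy_Integral_Formula" "HOL-Real_Asymp.Real_Asymp"
begin

text \<open>
  In the variable \<open>\<zeta> = x + i y\<close> of the strip the equation becomes \<open>Y' = A Y + h\<close> with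
  \<open>A = K \<psi>'\<close> and \<open>h = g \<psi>'\<close>. Since \<open>\<psi>'\<close> is \<open>Q(\<psi>)\<close> times a multiple of \<open>cosh \<zeta>\<close>, the hypotheses
  on \<open>K Q\<close> and \<open>g Q\<close> bound \<open>A\<close> and \<open>h\<close> by a multiple of \<open>cosh x exp (- \<alpha> \<pi> cos y \<bar>sinh x\<bar>)\<close>, which is
  integrable along horizontal lines. Picard iteration starting at the left end of the strip
  therefore converges uniformly. Integrating the bound for \<open>Y'\<close> from either end gives
  exactly the decay of \<open>\<bar>\<psi> - a\<bar>\<^sup>\<alpha>\<close> and \<open>\<bar>b - \<psi>\<bar>\<^sup>\<alpha>\<close>. On the interval, the pullback of the
  antiderivative of the bound serves as a continuous majorant, both for the absolute
  integrability of the singular right-hand side and for uniqueness by Gronwall's argument.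
\<close>

subsection \<open>An integrable majorant and its antiderivative\<close>

text \<open>
  The majorant is taken as \<open>cosh x / cosh (\<kappa> sinh x)\<close>, comparable to
  \<open>cosh x exp (- \<kappa> \<bar>sinh x\<bar>)\<close> but with an explicit smooth antiderivative.
\<close>

definition weight :: "real \<Rightarrow> real \<Rightarrow> real" where
  "weight \<kappa> x = cosh x / cosh (\<kappa> * sinh x)"

text \<open>With s = \<kappa> sinh x, \<open>weight \<kappa> x\<close> dx becomes (1 / \<kappa>) ds
  / cosh s, and 2 arctan (exp s) is the antiderivative of 1 / cosh s that vanishes at -infinity.
  Integration from the left end is thus plain evaluation.\<close>

definition weight_prim :: "real \<Rightarrow> real \<Rightarrow> real" where
  "weight_prim \<kappa> x = 2 / \<kappa> * arctan (exp (\<kappa> * sinh x))"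

lemma weight_pos [simp]: "0 < weight \<kappa> x"
  by (simp add: weight_def)

lemma weight_nonneg [simp]: "0 \<le> weight \<kappa> x"
  by (simp add: weight_def)

lemma weight_minus [simp]: "weight \<kappa> (- x) = weight \<kappa> x"
  by (simp add: weight_def)

text \<open>Since cosh is even and increasing on the nonnegative axis, a larger rate gives a larger
  denominator. This allows the rate on a single horizontal line to be replaced by the smaller rate
  at the edge of the strip.\<close>

lemma weight_antimono:
  assumes "0 \<le> \<kappa>" "\<kappa> \<le> \<kappa>'"
  shows "weight \<kappa>' x \<le> weight \<kappa> x"
proof -
  have "cosh (\<kappa> * sinh x) = cosh (\<kappa> * \<bar>sinh x\<bar>)" for \<kappa> :: real
    by (cases "0 \<le> sinh x") auto
  moreover have "cosh (\<kappa> * \<bar>sinh x\<bar>) \<le> cosh (\<kappa>' * \<bar>sinh x\<bar>)"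
    using assms by (subst cosh_real_nonneg_le_iff) (auto intro: mult_right_mono)
  ultimately have "cosh (\<kappa> * sinh x) \<le> cosh (\<kappa>' * sinh x)"
    by metis
  then show ?thesis
    unfolding weight_def by (intro divide_left_mono) auto
qed

lemma DERIV_weight_prim [derivative_intros]:
  assumes "\<kappa> \<noteq> 0"
  shows "(weight_prim \<kappa> has_real_derivative weight \<kappa> x) (at x)"
proof -
  have *: "2 * exp t / (1 + (exp t)\<^sup>2) = 1 / cosh t" for t :: real
    by (simp add: cosh_def exp_minus field_simps power2_eq_square)
  have "(weight_prim \<kappa> has_real_derivative
      2 / \<kappa> * (exp (\<kappa> * sinh x) * (\<kappa> * cosh x) / (1 + (exp (\<kappa> * sinh x))\<^sup>2))) (at x)"
    unfolding weight_prim_def [abs_def]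
    by (auto intro!: derivative_eq_intros simp: divide_inverse)
  also have "2 / \<kappa> * (exp (\<kappa> * sinh x) * (\<kappa> * cosh x) / (1 + (exp (\<kappa> * sinh x))\<^sup>2)) =
      cosh x * (2 * exp (\<kappa> * sinh x) / (1 + (exp (\<kappa> * sinh x))\<^sup>2))"
    using assms by simp
  also have "\<dots> = weight \<kappa> x"
    by (simp only: * weight_def) simp
  finally show ?thesis .
qed

lemma weight_prim_pos: "0 < \<kappa> \<Longrightarrow> 0 < weight_prim \<kappa> x"
  by (simp add: weight_prim_def)

lemma weight_prim_less: "0 < \<kappa> \<Longrightarrow> weight_prim \<kappa> x < pi / \<kappa>"
  using arctan_ubound[of "exp (\<kappa> * sinh x)"] by (simp add: weight_prim_def field_simps)

text \<open>From arctan t \<le> t. This decay for x -> -infinity later turns into the power of the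
  distance to \<open>a\<close>.\<close>

lemma weight_prim_le_exp:
  assumes "0 < \<kappa>"
  shows "weight_prim \<kappa> x \<le> 2 / \<kappa> * exp (\<kappa> * sinh x)"
  unfolding weight_prim_def using assms
  by (intro mult_left_mono arctan_le_self) auto

lemma weight_prim_at_bot: "0 < \<kappa> \<Longrightarrow> (weight_prim \<kappa> \<longlongrightarrow> 0) at_bot"
  unfolding weight_prim_def [abs_def] sinh_def real_scaleR_def by real_asymp

lemma weight_prim_at_top: "0 < \<kappa> \<Longrightarrow> (weight_prim \<kappa> \<longlongrightarrow> pi / \<kappa>) at_top"
  unfolding weight_prim_def [abs_def] sinh_def real_scaleR_def by real_asymp

lemma weight_at_bot: "0 < \<kappa> \<Longrightarrow> (weight \<kappa> \<longlongrightarrow> 0) at_bot"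
  unfolding weight_def [abs_def] sinh_def cosh_def real_scaleR_def by real_asymp

subsection \<open>Primitives on the strip\<close>

lemma open_strip [simp]: "open (strip d)"
  unfolding strip_def by (intro open_Collect_less continuous_intros)

lemma convex_strip [simp]: "convex (strip d)"
proof -
  have "strip d = Im -` {-d<..<d}" by (auto simp: strip_def)
  then show ?thesis
    by (simp add: convex_linear_vimage bounded_linear.linear bounded_linear_Im)
qed

lemma Complex_in_strip_iff [simp]: "Complex x y \<in> strip d \<longleftrightarrow> \<bar>y\<bar> < d"
  by (simp add: strip_def)

lemma of_real_in_strip_iff [simp]: "of_real x \<in> strip d \<longleftrightarrow> 0 < d"
  by (simp add: strip_def)

lemma uminus_in_strip_iff [simp]: "- \<zeta> \<in> strip d \<longleftrightarrow> \<zeta> \<in> strip d"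
  by (simp add: strip_def)

lemma Complex_Re_in_strip: "\<zeta> \<in> strip d \<Longrightarrow> Complex x (Im \<zeta>) \<in> strip d"
  by (simp add: strip_def)

lemma eventually_left_end:
  "eventually P (left_end d) \<longleftrightarrow> (\<exists>R. \<forall>\<zeta>\<in>strip d. Re \<zeta> \<le> R \<longrightarrow> P \<zeta>)"
  unfolding left_end_def eventually_inf_principal eventually_filtercomap eventually_at_bot_linorder
proof safe
  fix R assume "\<forall>\<zeta>\<in>strip d. Re \<zeta> \<le> R \<longrightarrow> P \<zeta>"
  then show "\<exists>Q. (\<exists>N. \<forall>n\<le>N. Q n) \<and> (\<forall>\<zeta>. Q (Re \<zeta>) \<longrightarrow> \<zeta> \<in> strip d \<longrightarrow> P \<zeta>)"
    by (intro exI[of _ "\<lambda>n. n \<le> R"]) auto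
qed blast

lemma eventually_right_end:
  "eventually P (right_end d) \<longleftrightarrow> (\<exists>R. \<forall>\<zeta>\<in>strip d. R \<le> Re \<zeta> \<longrightarrow> P \<zeta>)"
  unfolding right_end_def eventually_inf_principal eventually_filtercomap eventually_at_top_linorder
proof safe
  fix R assume "\<forall>\<zeta>\<in>strip d. R \<le> Re \<zeta> \<longrightarrow> P \<zeta>"
  then show "\<exists>Q. (\<exists>N. \<forall>n\<ge>N. Q n) \<and> (\<forall>\<zeta>. Q (Re \<zeta>) \<longrightarrow> \<zeta> \<in> strip d \<longrightarrow> P \<zeta>)"
    by (intro exI[of _ "\<lambda>n. R \<le> n"]) auto
qed blast

lemma eventually_strip_left_end: "\<forall>\<^sub>F \<zeta> in left_end d. \<zeta> \<in> strip d"
  by (simp add: eventually_left_end)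

lemma filterlim_Re_left_end: "filterlim Re at_bot (left_end d)"
  by (auto simp: filterlim_at_bot eventually_left_end)

text \<open>The reflection \<zeta> -> -\<zeta> reduces statements about the right end to the left
  end.\<close>

lemma filterlim_uminus_right_end: "filterlim uminus (left_end d) (right_end d)"
  unfolding filterlim_iff eventually_left_end eventually_right_end
proof safe
  fix P R
  assume "\<forall>\<zeta>\<in>strip d. Re \<zeta> \<le> R \<longrightarrow> P \<zeta>"
  then show "\<exists>R. \<forall>\<zeta>\<in>strip d. R \<le> Re \<zeta> \<longrightarrow> P (- \<zeta>)"
    by (intro exI[of _ "-R"]) auto
qed

lemma filterlim_Complex_left_end:
  assumes "\<bar>y\<bar> < d"
  shows "filterlim (\<lambda>x. Complex x y) (left_end d) at_bot"
  unfolding filterlim_iff eventually_left_end eventually_at_bot_linorder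
  using assms by (metis Complex_in_strip_iff complex.sel(1))

lemma filterlim_Complex_right_end:
  assumes "\<bar>y\<bar> < d"
  shows "filterlim (\<lambda>x. Complex x y) (right_end d) at_top"
  unfolding filterlim_iff eventually_right_end eventually_at_top_linorder
  using assms by (metis Complex_in_strip_iff complex.sel(1))

lemma has_vector_derivative_Complex_line:
  assumes "(F has_field_derivative f') (at (Complex x y))"
  shows "((\<lambda>x. F (Complex x y)) has_vector_derivative f') (at x)"
proof -
  have "((\<lambda>x. Complex x y) has_vector_derivative 1) (at x)"
    unfolding Complex_eq by (auto intro!: derivative_eq_intros)
  from field_vector_diff_chain_at[OF this assms] show ?thesis by (simp add: o_def)
qed

text \<open>Mean value inequality along one horizontal line. The bound on \<open>f\<close> is
  required on that line alone, so it may depend on the imaginary part.\<close>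

lemma horizontal_diff_bound:
  assumes F: "\<And>\<zeta>. \<zeta> \<in> strip d \<Longrightarrow> (F has_field_derivative f \<zeta>) (at \<zeta>)"
    and y: "\<bar>y\<bar> < d"
    and B: "\<And>x. (B has_real_derivative B' x) (at x)"
    and le: "\<And>x. norm (f (Complex x y)) \<le> B' x"
    and "x' \<le> x"
  shows "norm (F (Complex x y) - F (Complex x' y)) \<le> B x - B x'"
proof (cases "x' = x")
  case False
  have d: "((\<lambda>x. F (Complex x y)) has_vector_derivative f (Complex x y)) (at x)" for x
    using F y by (intro has_vector_derivative_Complex_line) simp
  have B': "(B has_vector_derivative B' x) (at x)" for x
    using B by (simp add: has_real_derivative_iff_has_vector_derivative)
  show ?thesis
    using False \<open>x' \<le> x\<close> d le B'
    by (intro differentiable_bound_general[where f' = "\<lambda>x. f (Complex x y)" and \<phi>' = B'])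
       (auto intro!: has_vector_derivative_continuous continuous_at_imp_continuous_on)
qed auto

text \<open>The increment bound between x' and \<open>Re \<zeta>\<close> is passed to the limit x'
  -> -infinity; nonnegativity of \<open>B\<close> discards the term \<open>B x'\<close>.\<close>

lemma horizontal_bound_left_end:
  assumes F: "\<And>\<zeta>. \<zeta> \<in> strip d \<Longrightarrow> (F has_field_derivative f \<zeta>) (at \<zeta>)"
    and lim: "(F \<longlongrightarrow> l) (left_end d)"
    and \<zeta>: "\<zeta> \<in> strip d"
    and B: "\<And>x. (B has_real_derivative B' x) (at x)" and B0: "\<And>x. 0 \<le> B x"
    and le: "\<And>x. norm (f (Complex x (Im \<zeta>))) \<le> B' x"
  shows "norm (F \<zeta> - l) \<le> B (Re \<zeta>)"
proof (rule tendsto_upperbound)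
  have y: "\<bar>Im \<zeta>\<bar> < d" using \<zeta> by (simp add: strip_def)
  show "((\<lambda>x'. norm (F \<zeta> - F (Complex x' (Im \<zeta>)))) \<longlongrightarrow> norm (F \<zeta> - l)) at_bot"
    by (intro tendsto_intros filterlim_compose[OF lim] filterlim_Complex_left_end y)
  show "\<forall>\<^sub>F x' in at_bot. norm (F \<zeta> - F (Complex x' (Im \<zeta>))) \<le> B (Re \<zeta>)"
    using eventually_le_at_bot[of "Re \<zeta>"]
  proof eventually_elim
    case (elim x')
    then show ?case
      using horizontal_diff_bound[OF F y B le elim] B0[of x'] by simp
  qed
qed auto

text \<open>The derivative bound is uniform in the imaginary part, so horizontal increments are
  controlled by \<open>weight_prim\<close> and vertical ones by \<open>d\<close> times
  \<open>weight\<close>. Both tend to 0 at the left end. Hence the values at the negative integers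
  form a Cauchy sequence, and its limit is the limit along the whole filter.\<close>

lemma left_end_limit_exists:
  assumes F: "\<And>\<zeta>. \<zeta> \<in> strip d \<Longrightarrow> (F has_field_derivative f \<zeta>) (at \<zeta>)"
    and "0 < d" and \<kappa>: "0 < \<kappa>" and "0 \<le> C"
    and le: "\<And>\<zeta>. \<zeta> \<in> strip d \<Longrightarrow> norm (f \<zeta>) \<le> C * weight \<kappa> (Re \<zeta>)"
  obtains l where "(F \<longlongrightarrow> l) (left_end d)"
proof -
  have hor: "norm (F (of_real x) - F (of_real x')) \<le> C * weight_prim \<kappa> x" if "x' \<le> x" for x x'
  proof -
    have "norm (F (Complex x 0) - F (Complex x' 0)) \<le> C * weight_prim \<kappa> x - C * weight_prim \<kappa> x'"
    proof (rule horizontal_diff_bound[OF F])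
      show "((\<lambda>x. C * weight_prim \<kappa> x) has_real_derivative C * weight \<kappa> x) (at x)" for x
        using \<kappa> by (auto intro!: derivative_eq_intros)
      show "norm (f (Complex x 0)) \<le> C * weight \<kappa> x" for x
        using le[of "Complex x 0"] \<open>0 < d\<close> by simp
    qed (use that \<open>0 < d\<close> in auto)
    moreover have "0 \<le> C * weight_prim \<kappa> x'"
      using weight_prim_pos[OF \<kappa>, of x'] \<open>0 \<le> C\<close> by simp
    ultimately show ?thesis by (simp add: complex_of_real_def)
  qed
  \<comment> \<open>The first term pays for the vertical move from \<zeta> to the real axis, the
    second for the move to the left along the axis.\<close>
  define \<epsilon> where "\<epsilon> x = C * weight \<kappa> x * d + C * weight_prim \<kappa> x" for x
  have \<epsilon>: "(\<epsilon> \<longlongrightarrow> 0) at_bot"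
    unfolding \<epsilon>_def
    using \<kappa> by (auto intro!: tendsto_eq_intros weight_at_bot weight_prim_at_bot)
  have diff: "norm (F \<zeta> - F (of_real x')) \<le> \<epsilon> (Re \<zeta>)" if \<zeta>: "\<zeta> \<in> strip d" and "x' \<le> Re \<zeta>" for \<zeta> x'
  proof -
    \<comment> \<open>On a vertical segment \<open>weight\<close> is constant, so the mean value
      inequality applies with a constant bound.\<close>
    let ?S = "{\<xi>. Re \<xi> = Re \<zeta>} \<inter> strip d"
    have "norm (F \<zeta> - F (of_real (Re \<zeta>))) \<le> C * weight \<kappa> (Re \<zeta>) * norm (\<zeta> - of_real (Re \<zeta>))"
    proof (rule field_differentiable_bound[of ?S])
      have "{\<xi>. Re \<xi> = Re \<zeta>} = Re -` {Re \<zeta>}" by auto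
      then show "convex ?S"
        by (intro convex_Int convex_strip)
           (simp add: convex_linear_vimage bounded_linear.linear bounded_linear_Re)
      fix \<xi> assume \<xi>: "\<xi> \<in> ?S"
      show "(F has_field_derivative f \<xi>) (at \<xi> within ?S)"
        using F \<xi> by (blast intro: has_field_derivative_at_within)
      show "norm (f \<xi>) \<le> C * weight \<kappa> (Re \<zeta>)" using le[of \<xi>] \<xi> by simp
    qed (use \<zeta> \<open>0 < d\<close> in auto)
    also have "norm (\<zeta> - of_real (Re \<zeta>)) = \<bar>Im \<zeta>\<bar>" by (simp add: cmod_def)
    also have "C * weight \<kappa> (Re \<zeta>) * \<bar>Im \<zeta>\<bar> \<le> C * weight \<kappa> (Re \<zeta>) * d"
      using \<zeta> \<open>0 \<le> C\<close> by (intro mult_left_mono) (auto simp: strip_def)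
    finally have "norm (F \<zeta> - F (of_real (Re \<zeta>))) \<le> C * weight \<kappa> (Re \<zeta>) * d" .
    from norm_diff_triangle_le[OF this hor[OF that(2)]] show ?thesis
      by (simp add: \<epsilon>_def)
  qed
  have "Cauchy (\<lambda>n. F (of_real (- real n)))"
  proof (rule metric_CauchyI)
    fix e :: real assume "0 < e"
    have "\<forall>\<^sub>F n in sequentially. \<epsilon> (- real n) < e"
      by (rule order_tendstoD(2)[OF filterlim_compose[OF \<epsilon>] \<open>0 < e\<close>]) real_asymp
    then obtain N where N: "\<And>n. N \<le> n \<Longrightarrow> \<epsilon> (- real n) < e"
      by (auto simp: eventually_sequentially)
    have "dist (F (of_real (- real m))) (F (of_real (- real n))) < e" if "N \<le> m" "m \<le> n" for m n
    proof -
      have "of_real (- real m) \<in> strip d" using \<open>0 < d\<close> of_real_in_strip_iff by blast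
      from diff[OF this, of "- real n"] N[of m] that show ?thesis by (simp add: dist_norm)
    qed
    then show "\<exists>M. \<forall>m\<ge>M. \<forall>n\<ge>M. dist (F (of_real (- real m))) (F (of_real (- real n))) < e"
      by (metis dist_commute nle_le)
  qed
  then obtain l where l: "(\<lambda>n. F (of_real (- real n))) \<longlonglongrightarrow> l"
    by (auto simp: Cauchy_convergent_iff convergent_def)
  have "norm (F \<zeta> - l) \<le> \<epsilon> (Re \<zeta>)" if \<zeta>: "\<zeta> \<in> strip d" for \<zeta>
  proof (rule tendsto_upperbound)
    show "(\<lambda>n. norm (F \<zeta> - F (of_real (- real n)))) \<longlonglongrightarrow> norm (F \<zeta> - l)"
      by (intro tendsto_intros l)
    have "\<forall>\<^sub>F n in sequentially. - real n \<le> Re \<zeta>" by real_asymp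
    then show "\<forall>\<^sub>F n in sequentially. norm (F \<zeta> - F (of_real (- real n))) \<le> \<epsilon> (Re \<zeta>)"
      by eventually_elim (rule diff[OF \<zeta>])
  qed auto
  then have "\<forall>\<^sub>F \<zeta> in left_end d. norm (F \<zeta> - l) \<le> \<epsilon> (Re \<zeta>)"
    by (auto simp: eventually_left_end)
  then have "((\<lambda>\<zeta>. F \<zeta> - l) \<longlongrightarrow> 0) (left_end d)"
    by (rule Lim_null_comparison) (rule filterlim_compose[OF \<epsilon> filterlim_Re_left_end])
  with that show thesis by (simp add: LIM_zero_iff)
qed

text \<open>A holomorphic function on the convex strip has a primitive by Cauchy's theorem. Its
  limit at the left end exists by the bound and is shifted to \<open>c\<close>, which encodes an
  initial value at -infinity.\<close>

lemma primitive_left_end: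
  assumes f: "f holomorphic_on strip d"
    and "0 < d" "0 < \<kappa>" "0 \<le> C"
    and le: "\<And>\<zeta>. \<zeta> \<in> strip d \<Longrightarrow> norm (f \<zeta>) \<le> C * weight \<kappa> (Re \<zeta>)"
  obtains F where "\<And>\<zeta>. \<zeta> \<in> strip d \<Longrightarrow> (F has_field_derivative f \<zeta>) (at \<zeta>)"
    and "(F \<longlongrightarrow> c) (left_end d)"
proof -
  obtain F0 where "\<And>\<zeta>. \<zeta> \<in> strip d \<Longrightarrow> (F0 has_field_derivative f \<zeta>) (at \<zeta> within strip d)"
    using holomorphic_convex_primitive'[OF convex_strip open_strip f] by blast
  then have F0: "(F0 has_field_derivative f \<zeta>) (at \<zeta>)" if "\<zeta> \<in> strip d" for \<zeta>
    using that at_within_open[OF that open_strip] by metis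
  obtain l where l: "(F0 \<longlongrightarrow> l) (left_end d)"
    using left_end_limit_exists[OF F0 assms(2-5)] by blast
  show thesis
  proof (rule that[of "\<lambda>\<zeta>. F0 \<zeta> - l + c"])
    show "((\<lambda>\<zeta>. F0 \<zeta> - l + c) has_field_derivative f \<zeta>) (at \<zeta>)" if "\<zeta> \<in> strip d" for \<zeta>
      using F0[OF that] by (auto intro!: derivative_eq_intros)
    show "((\<lambda>\<zeta>. F0 \<zeta> - l + c) \<longlongrightarrow> c) (left_end d)"
      by (rule tendsto_eq_intros l refl)+ simp
  qed
qed

subsection \<open>Linear systems on the strip\<close>

text \<open>The bound refers only to the line through \<zeta>, so that \<kappa> can be chosen
  depending on \<open>Im \<zeta>\<close>. The sign of \<open>C\<close> follows from the bound
  itself.\<close>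

lemma weight_bound_left_end:
  assumes F: "\<And>\<zeta>. \<zeta> \<in> strip d \<Longrightarrow> (F has_field_derivative f \<zeta>) (at \<zeta>)"
    and lim: "(F \<longlongrightarrow> l) (left_end d)"
    and \<zeta>: "\<zeta> \<in> strip d" and \<kappa>: "0 < \<kappa>"
    and le: "\<And>x. norm (f (Complex x (Im \<zeta>))) \<le> C * weight \<kappa> x"
  shows "norm (F \<zeta> - l) \<le> C * weight_prim \<kappa> (Re \<zeta>)"
proof (rule horizontal_bound_left_end[OF F lim \<zeta> _ _ le])
  have "0 \<le> C * weight \<kappa> 0" using le[of 0] norm_ge_zero order_trans by blast
  then have "0 \<le> C" by (metis weight_pos zero_le_mult_iff not_le)
  then show "0 \<le> C * weight_prim \<kappa> x" for x
    using weight_prim_pos[OF \<kappa>, of x] by simp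
  show "((\<lambda>x. C * weight_prim \<kappa> x) has_real_derivative C * weight \<kappa> x) (at x)" for x
    using \<kappa> by (auto intro!: derivative_eq_intros)
qed

text \<open>Picard iteration with the initial value prescribed at the left end. The iterates
  converge uniformly on the whole strip, and this carries the differential equation, the limit at
  the left end and boundedness over to the limit function.\<close>

lemma linear_system_on_strip:
  fixes A :: "'n::finite \<Rightarrow> 'n \<Rightarrow> complex \<Rightarrow> complex"
  assumes A: "\<And>i j. A i j holomorphic_on strip d"
    and h: "\<And>i. h i holomorphic_on strip d"
    and d: "0 < d" and \<kappa>: "0 < \<kappa>" and L: "0 < L"
    and A_le: "\<And>i j \<zeta>. \<zeta> \<in> strip d \<Longrightarrow> norm (A i j \<zeta>) \<le> L * weight \<kappa> (Re \<zeta>)"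
    and h_le: "\<And>i \<zeta>. \<zeta> \<in> strip d \<Longrightarrow> norm (h i \<zeta>) \<le> L * weight \<kappa> (Re \<zeta>)"
  obtains Y where
    "\<And>i \<zeta>. \<zeta> \<in> strip d \<Longrightarrow>
      (Y i has_field_derivative (\<Sum>j\<in>UNIV. A i j \<zeta> * Y j \<zeta>) + h i \<zeta>) (at \<zeta>)"
    and "\<And>i. (Y i \<longlongrightarrow> r i) (left_end d)"
    and "\<And>i. bounded (Y i ` strip d)"
proof -
  define R where "R V i \<zeta> = (\<Sum>j\<in>UNIV. A i j \<zeta> * V j \<zeta>) + h i \<zeta>" for V i \<zeta>
  \<comment> \<open>Invariant of the iteration. Boundedness of \<open>V\<close> keeps
    \<open>R V i\<close> below a multiple of \<open>weight \<kappa>\<close>, so a primitive with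
    limit \<open>r i\<close> at the left end exists and is bounded again.\<close>
  define ok where "ok V \<longleftrightarrow> (\<forall>i. V i holomorphic_on strip d \<and> (V i \<longlongrightarrow> r i) (left_end d)) \<and>
      (\<exists>B. \<forall>i. \<forall>\<zeta>\<in>strip d. norm (V i \<zeta>) \<le> B)" for V :: "'n \<Rightarrow> complex \<Rightarrow> complex"
  define N where "N = real CARD('n)"
  have N: "0 < N" by (simp add: N_def)
  have sum_le: "norm (\<Sum>j\<in>UNIV. A i j \<zeta> * v j) \<le> N * L * B * weight \<kappa> (Re \<zeta>)"
    if "\<zeta> \<in> strip d" "\<And>j. norm (v j) \<le> B" for i \<zeta> v B
  proof -
    have "norm (\<Sum>j\<in>UNIV. A i j \<zeta> * v j) \<le> (\<Sum>j\<in>(UNIV::'n set). L * weight \<kappa> (Re \<zeta>) * B)"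
    proof (rule sum_norm_le)
      fix j
      show "norm (A i j \<zeta> * v j) \<le> L * weight \<kappa> (Re \<zeta>) * B"
        unfolding norm_mult using A_le that L by (intro mult_mono) auto
    qed
    then show ?thesis by (simp add: N_def mult_ac)
  qed
  have step: "\<exists>W. ok W \<and> (\<forall>i. \<forall>\<zeta>\<in>strip d. (W i has_field_derivative R V i \<zeta>) (at \<zeta>))"
    if V: "ok V" for V
  proof -
    obtain B0 where B0: "\<And>i \<zeta>. \<zeta> \<in> strip d \<Longrightarrow> norm (V i \<zeta>) \<le> B0"
      using V unfolding ok_def by blast
    define B where "B = max B0 0"
    have B: "norm (V i \<zeta>) \<le> B" if "\<zeta> \<in> strip d" for i \<zeta>
      using B0[OF that, of i] by (simp add: B_def)
    \<comment> \<open>The N summands contribute \<open>L * B\<close> each, the inhomogeneity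
      contributes \<open>L\<close>.\<close>
    define C where "C = (N * B + 1) * L"
    have C: "0 \<le> C" using L N by (simp add: C_def B_def)
    have R_le: "norm (R V i \<zeta>) \<le> C * weight \<kappa> (Re \<zeta>)" if \<zeta>: "\<zeta> \<in> strip d" for i \<zeta>
      using norm_triangle_mono[OF sum_le[where v = "\<lambda>j. V j \<zeta>", OF \<zeta> B[OF \<zeta>], of i] h_le[OF \<zeta>, of i]]
      by (simp add: R_def C_def algebra_simps)
    have hol: "R V i holomorphic_on strip d" for i
      unfolding R_def using V A h by (auto intro!: holomorphic_intros simp: ok_def)
    have "\<exists>W. (\<forall>\<zeta>\<in>strip d. (W has_field_derivative R V i \<zeta>) (at \<zeta>)) \<and> (W \<longlongrightarrow> r i) (left_end d)" for i
      using primitive_left_end[OF hol d \<kappa> C R_le] by metis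
    then obtain W where W: "\<And>i \<zeta>. \<zeta> \<in> strip d \<Longrightarrow> (W i has_field_derivative R V i \<zeta>) (at \<zeta>)"
      and W_lim: "\<And>i. (W i \<longlongrightarrow> r i) (left_end d)"
      by metis
    have "norm (W i \<zeta>) \<le> C * (pi / \<kappa>) + (\<Sum>i\<in>UNIV. norm (r i))" if \<zeta>: "\<zeta> \<in> strip d" for i \<zeta>
    proof -
      have "norm (W i \<zeta> - r i) \<le> C * weight_prim \<kappa> (Re \<zeta>)"
        using R_le[OF Complex_Re_in_strip[OF \<zeta>]]
        by (intro weight_bound_left_end[OF W W_lim \<zeta> \<kappa>]) auto
      also have "\<dots> \<le> C * (pi / \<kappa>)"
        using C less_imp_le[OF weight_prim_less[OF \<kappa>]] by (intro mult_left_mono)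
      finally have "norm (W i \<zeta> - r i) \<le> C * (pi / \<kappa>)" .
      moreover have "norm (r i) \<le> (\<Sum>i\<in>UNIV. norm (r i))"
        by (rule member_le_sum) auto
      ultimately show ?thesis
        using norm_triangle_sub[of "W i \<zeta>" "r i"] by linarith
    qed
    moreover have "W i holomorphic_on strip d" for i
      using W by (auto simp: holomorphic_on_open)
    ultimately have "ok W"
      unfolding ok_def using W_lim by blast
    with W show ?thesis by blast
  qed
  have "ok (\<lambda>i _. r i)"
    unfolding ok_def by (auto intro!: exI[of _ "\<Sum>i\<in>UNIV. norm (r i)"] member_le_sum)
  then have "\<exists>V. \<forall>n. ok (V n) \<and>
      (\<forall>i. \<forall>\<zeta>\<in>strip d. (V (Suc n) i has_field_derivative R (V n) i \<zeta>) (at \<zeta>))"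
    using step by (intro dependent_nat_choice) auto
  then obtain V where ok: "\<And>n. ok (V n)"
    and V: "\<And>n i \<zeta>. \<zeta> \<in> strip d \<Longrightarrow> (V (Suc n) i has_field_derivative R (V n) i \<zeta>) (at \<zeta>)"
    by blast
  have V_lim: "(V n i \<longlongrightarrow> r i) (left_end d)" for n i
    using ok[of n] by (simp add: ok_def)
  have V_bdd: "\<exists>B. \<forall>i. \<forall>\<zeta>\<in>strip d. norm (V n i \<zeta>) \<le> B" for n
    using ok[of n] by (simp add: ok_def)

  obtain B0 where B0: "\<And>i \<zeta>. \<zeta> \<in> strip d \<Longrightarrow> norm (V 0 i \<zeta>) \<le> B0"
    using V_bdd[of 0] by blast
  obtain B1 where B1: "\<And>i \<zeta>. \<zeta> \<in> strip d \<Longrightarrow> norm (V 1 i \<zeta>) \<le> B1"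
    using V_bdd[of 1] by blast
  define C where "C = max 0 (B0 + B1)"
  have C: "0 \<le> C" by (simp add: C_def)
  \<comment> \<open>The homogeneous part is bounded by \<open>N * L * weight \<kappa>\<close>. The
    factor 2 makes g / 2 an antiderivative of N L weight g, so each integration halves the weighted
    bound.\<close>
  define \<mu> where "\<mu> = 2 * N * L"
  define g where "g x = exp (\<mu> * weight_prim \<kappa> x)" for x
  have g1: "1 \<le> g x" for x
    using weight_prim_pos[OF \<kappa>, of x] N L by (simp add: g_def \<mu>_def)
  have g_le: "g x \<le> exp (\<mu> * (pi / \<kappa>))" for x
    unfolding g_def exp_le_cancel_iff using N L less_imp_le[OF weight_prim_less[OF \<kappa>]]
    by (intro mult_left_mono) (auto simp: \<mu>_def)
  have g_deriv: "(g has_real_derivative \<mu> * weight \<kappa> x * g x) (at x)" for x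
    unfolding g_def [abs_def] using \<kappa> by (auto intro!: derivative_eq_intros)
  \<comment> \<open>With the weight \<open>g\<close> the Picard map is a contraction with constant 1/2.\<close>
  have D: "norm (V (Suc n) i \<zeta> - V n i \<zeta>) \<le> C * g (Re \<zeta>) / 2 ^ n" if "\<zeta> \<in> strip d" for n i \<zeta>
    using that
  proof (induction n arbitrary: i \<zeta>)
    case 0
    have "norm (V 1 i \<zeta> - V 0 i \<zeta>) \<le> C"
      using norm_triangle_ineq4[of "V 1 i \<zeta>" "V 0 i \<zeta>"] B0[OF 0, of i] B1[OF 0, of i]
      by (simp add: C_def)
    also have "C * 1 \<le> C * g (Re \<zeta>)" by (intro mult_left_mono g1 C)
    finally show ?case by simp
  next
    case (Suc n)
    have "norm (V (Suc (Suc n)) i \<zeta> - V (Suc n) i \<zeta> - 0) \<le> C * g (Re \<zeta>) / 2 ^ Suc n"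
    proof (rule horizontal_bound_left_end[where F = "\<lambda>\<zeta>. V (Suc (Suc n)) i \<zeta> - V (Suc n) i \<zeta>"
          and f = "\<lambda>\<zeta>. \<Sum>j\<in>UNIV. A i j \<zeta> * (V (Suc n) j \<zeta> - V n j \<zeta>)"])
      fix \<xi> assume \<xi>: "\<xi> \<in> strip d"
      have "((\<lambda>\<zeta>. V (Suc (Suc n)) i \<zeta> - V (Suc n) i \<zeta>) has_field_derivative
          R (V (Suc n)) i \<xi> - R (V n) i \<xi>) (at \<xi>)"
        by (intro DERIV_diff V \<xi>)
      then show "((\<lambda>\<zeta>. V (Suc (Suc n)) i \<zeta> - V (Suc n) i \<zeta>) has_field_derivative
          (\<Sum>j\<in>UNIV. A i j \<xi> * (V (Suc n) j \<xi> - V n j \<xi>))) (at \<xi>)"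
        by (simp add: R_def sum_subtractf algebra_simps)
    next
      show "((\<lambda>\<zeta>. V (Suc (Suc n)) i \<zeta> - V (Suc n) i \<zeta>) \<longlongrightarrow> 0) (left_end d)"
        using tendsto_diff[OF V_lim[of "Suc (Suc n)" i] V_lim[of "Suc n" i]] by simp
    next
      show "((\<lambda>x. C * g x / 2 ^ Suc n) has_real_derivative
          C * (\<mu> * weight \<kappa> x * g x) / 2 ^ Suc n) (at x)" for x
        by (auto intro!: derivative_eq_intros g_deriv)
    next
      show "0 \<le> C * g x / 2 ^ Suc n" for x
        using C g1[of x] by simp
    next
      fix x
      let ?\<xi> = "Complex x (Im \<zeta>)"
      have \<xi>: "?\<xi> \<in> strip d" using Suc.prems by (rule Complex_Re_in_strip)
      have "norm (\<Sum>j\<in>UNIV. A i j ?\<xi> * (V (Suc n) j ?\<xi> - V n j ?\<xi>))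
          \<le> N * L * (C * g (Re ?\<xi>) / 2 ^ n) * weight \<kappa> (Re ?\<xi>)"
        by (rule sum_le[OF \<xi> Suc.IH[OF \<xi>]])
      also have "\<dots> = C * (\<mu> * weight \<kappa> x * g x) / 2 ^ Suc n"
        by (simp add: \<mu>_def)
      finally show "norm (\<Sum>j\<in>UNIV. A i j ?\<xi> * (V (Suc n) j ?\<xi> - V n j ?\<xi>)) \<le> \<dots>" .
    qed (rule Suc.prems)
    then show ?case by simp
  qed
  \<comment> \<open>Because \<open>weight_prim\<close> is bounded, so is \<open>g\<close>; the
    geometric bound becomes uniform on the strip and feeds the Weierstrass test.\<close>
  have D': "norm (V (Suc n) i \<zeta> - V n i \<zeta>) \<le> C * exp (\<mu> * (pi / \<kappa>)) * (1/2) ^ n"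
    if "\<zeta> \<in> strip d" for n i \<zeta>
  proof -
    have "C * g (Re \<zeta>) / 2 ^ n \<le> C * exp (\<mu> * (pi / \<kappa>)) / 2 ^ n"
      by (intro divide_right_mono mult_left_mono g_le C) auto
    with D[OF that, of n i] show ?thesis by (simp add: power_one_over field_simps)
  qed
  have "\<exists>Y. uniform_limit (strip d) (\<lambda>n. V n i) Y sequentially" for i
  proof -
    have "uniform_limit (strip d) (\<lambda>n \<zeta>. \<Sum>k<n. V (Suc k) i \<zeta> - V k i \<zeta>)
        (\<lambda>\<zeta>. suminf (\<lambda>k. V (Suc k) i \<zeta> - V k i \<zeta>)) sequentially"
      by (rule Weierstrass_m_test[OF D']) (auto intro!: summable_mult)
    then have ul: "uniform_limit (strip d) (\<lambda>n \<zeta>. (\<Sum>k<n. V (Suc k) i \<zeta> - V k i \<zeta>) + V 0 i \<zeta>)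
        (\<lambda>\<zeta>. suminf (\<lambda>k. V (Suc k) i \<zeta> - V k i \<zeta>) + V 0 i \<zeta>) sequentially"
      by (intro uniform_limit_add uniform_limit_const)
    have "(\<Sum>k<n. V (Suc k) i \<zeta> - V k i \<zeta>) + V 0 i \<zeta> = V n i \<zeta>" for n \<zeta>
      using sum_lessThan_telescope[of "\<lambda>k. V k i \<zeta>" n] by simp
    with ul show ?thesis by (simp only:) blast
  qed
  then obtain Y where Y: "\<And>i. uniform_limit (strip d) (\<lambda>n. V n i) (Y i) sequentially"
    by metis
  have Y_pt: "(\<lambda>n. V n i \<zeta>) \<longlonglongrightarrow> Y i \<zeta>" if "\<zeta> \<in> strip d" for i \<zeta>
    by (rule tendsto_uniform_limitI[OF Y that])
  show thesis
  proof (rule that[of Y])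
    fix i \<zeta> assume \<zeta>: "\<zeta> \<in> strip d"
    \<comment> \<open>The index is shifted because it is \<open>V (Suc n)\<close> whose derivative
      is \<open>R (V n)\<close>. The derivatives then converge both to the derivative of the limit
      and to \<open>R Y\<close>.\<close>
    have ul: "uniform_limit (strip d) (\<lambda>n. V (Suc n) i) (Y i) sequentially"
      by (rule filterlim_compose[OF Y filterlim_Suc])
    have *: "\<exists>e>0. cball x e \<subseteq> strip d \<and> uniform_limit (cball x e) (\<lambda>n. V (Suc n) i) (Y i) sequentially"
      if "x \<in> strip d" for x
      using open_contains_cball that uniform_limit_on_subset[OF ul] open_strip by metis
    have "\<exists>g'. \<forall>x\<in>strip d. (Y i has_field_derivative g' x) (at x) \<and> (\<lambda>n. R (V n) i x) \<longlonglongrightarrow> g' x"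
      by (rule has_complex_derivative_uniform_sequence[where f = "\<lambda>n. V (Suc n) i", OF open_strip V *])
    then obtain g' where g': "\<And>x. x \<in> strip d \<Longrightarrow> (Y i has_field_derivative g' x) (at x)"
      "\<And>x. x \<in> strip d \<Longrightarrow> (\<lambda>n. R (V n) i x) \<longlonglongrightarrow> g' x"
      by blast
    have "(\<lambda>n. R (V n) i \<zeta>) \<longlonglongrightarrow> R Y i \<zeta>"
      unfolding R_def by (intro tendsto_intros Y_pt \<zeta>)
    then have "g' \<zeta> = R Y i \<zeta>" using g'(2)[OF \<zeta>] LIMSEQ_unique by blast
    then show "(Y i has_field_derivative (\<Sum>j\<in>UNIV. A i j \<zeta> * Y j \<zeta>) + h i \<zeta>) (at \<zeta>)"
      using g'(1)[OF \<zeta>] by (simp add: R_def)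
  next
    fix i
    \<comment> \<open>A single iterate that is uniformly close to \<open>Y i\<close> transfers both
      its limit at the left end and its boundedness.\<close>
    have near: "\<exists>n. \<forall>\<zeta>\<in>strip d. dist (V n i \<zeta>) (Y i \<zeta>) < e" if "0 < e" for e
      using uniform_limitD[OF Y[of i] that] by (auto simp: eventually_sequentially)
    show "(Y i \<longlongrightarrow> r i) (left_end d)"
    proof (rule tendstoI)
      fix e :: real assume e: "0 < e"
      then obtain n where n: "\<And>\<zeta>. \<zeta> \<in> strip d \<Longrightarrow> dist (V n i \<zeta>) (Y i \<zeta>) < e / 2"
        using near[of "e/2"] by auto
      have "\<forall>\<^sub>F \<zeta> in left_end d. dist (V n i \<zeta>) (r i) < e / 2"
        using V_lim e by (intro tendstoD) auto
      with eventually_strip_left_end show "\<forall>\<^sub>F \<zeta> in left_end d. dist (Y i \<zeta>) (r i) < e"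
        by eventually_elim (use n dist_triangle_half_r in blast)
    qed
    obtain n where n: "\<And>\<zeta>. \<zeta> \<in> strip d \<Longrightarrow> dist (V n i \<zeta>) (Y i \<zeta>) < 1"
      using near[of 1] by auto
    obtain B where B: "\<And>\<zeta>. \<zeta> \<in> strip d \<Longrightarrow> norm (V n i \<zeta>) \<le> B"
      using V_bdd[of n] by blast
    have "norm (Y i \<zeta>) \<le> B + 1" if "\<zeta> \<in> strip d" for \<zeta>
      using n[OF that] B[OF that] norm_triangle_sub[of "Y i \<zeta>" "V n i \<zeta>"]
      by (simp add: dist_norm norm_minus_commute)
    then show "bounded (Y i ` strip d)"
      by (auto simp: bounded_iff)
  qed
qed

subsection \<open>The double exponential map\<close>

lemma Re_sinh: "Re (sinh z) = sinh (Re z) * cos (Im z)"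
  by (simp add: sinh_def Re_exp algebra_simps)

lemma Im_sinh: "Im (sinh z) = cosh (Re z) * sin (Im z)"
  by (simp add: sinh_def cosh_def Im_exp algebra_simps)

text \<open>From cosh (x + i y) = cosh x cos y + i sinh x sin y. Written as a sum of two squares,
  each summand is a lower bound by itself.\<close>

lemma norm_cosh_squared: "(norm (cosh z))\<^sup>2 = (sinh (Re z))\<^sup>2 + (cos (Im z))\<^sup>2" for z :: complex
proof -
  have "Re (cosh z) = cosh (Re z) * cos (Im z)" "Im (cosh z) = sinh (Re z) * sin (Im z)"
    by (simp_all add: cosh_def sinh_def Re_exp Im_exp algebra_simps)
  then have "(norm (cosh z))\<^sup>2 = (cosh (Re z))\<^sup>2 * (cos (Im z))\<^sup>2 + (sinh (Re z))\<^sup>2 * (sin (Im z))\<^sup>2"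
    by (simp add: cmod_power2 power_mult_distrib)
  then show ?thesis by (simp add: cosh_square_eq sin_squared_eq algebra_simps)
qed

lemma norm_cosh_le: "norm (cosh z) \<le> cosh (Re z)" for z :: complex
proof (rule power2_le_imp_le)
  have "(cos (Im z))\<^sup>2 \<le> 1" by (simp add: abs_square_le_1)
  then show "(norm (cosh z))\<^sup>2 \<le> (cosh (Re z))\<^sup>2"
    by (simp add: norm_cosh_squared cosh_square_eq)
qed simp

lemma cosh_real_le_exp_abs: "cosh x \<le> exp \<bar>x\<bar>" for x :: real
  by (cases "0 \<le> x") (auto simp: cosh_def)

lemma cos_strip:
  assumes "d < pi / 2" "\<bar>y\<bar> < d"
  shows "0 < cos d" "cos d \<le> cos y" "\<bar>sin y\<bar> \<le> sin d"
proof -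
  show "0 < cos d" using assms by (intro cos_gt_zero) auto
  have "cos d \<le> cos \<bar>y\<bar>" using assms by (intro cos_monotone_0_pi_le) auto
  then show "cos d \<le> cos y" by simp
  have "sin y \<le> sin d" "sin (- y) \<le> sin d"
    using assms by (auto intro!: sin_monotone_2pi_le simp del: sin_minus)
  then show "\<bar>sin y\<bar> \<le> sin d" by simp
qed

text \<open>Write w = (pi / 2) sinh \<zeta>. If \<open>sinh (Re \<zeta>)\<close> is small, then
  \<open>cosh (Re \<zeta>)\<close> is close to 1 and, as sin d < 1, \<bar>Im w\<bar> stays away from
  pi / 2, so cos (Im w) is bounded below. Otherwise \<bar>Re w\<bar> is bounded below and sinh
  \<bar>Re w\<bar> is comparable to exp \<bar>Re w\<bar>.\<close>

lemma cosh_sinh_lower_bound: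
  assumes d: "0 < d" "d < pi / 2"
  obtains c where "0 < c"
    and "\<And>\<zeta>. \<zeta> \<in> strip d \<Longrightarrow>
      c * exp \<bar>pi / 2 * sinh (Re \<zeta>) * cos (Im \<zeta>)\<bar> \<le> norm (cosh (of_real (pi / 2) * sinh \<zeta>))"
proof -
  define p where "p = sin d"
  have p: "0 < p" "p < 1"
    using d sin_gt_zero[of d] sin_monotone_2pi[of d "pi / 2"] by (auto simp: p_def)
  \<comment> \<open>The threshold between the two cases is chosen so that (1 + s0) p \<le> p + s0 =
    (1 + p) / 2 < 1. Then \<gamma> bounds cos (Im w) below in the first case and \<open>u0\<close>
    bounds \<bar>Re w\<bar> below in the second.\<close>
  define s0 where "s0 = (1 - p) / 2"
  define \<gamma> where "\<gamma> = cos ((1 + p) / 2 * (pi / 2))"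
  define u0 where "u0 = pi / 2 * s0 * cos d"
  have cosd: "0 < cos d" using d by (intro cos_gt_zero) auto
  have s0: "0 < s0" using p by (simp add: s0_def)
  have u0: "0 < u0" using s0 cosd by (simp add: u0_def)
  have \<gamma>: "0 < \<gamma>"
    unfolding \<gamma>_def using p by (intro cos_gt_zero mult_pos_pos) auto
  \<comment> \<open>The first entry compensates exp \<bar>Re w\<bar> \<le> exp (pi / 2 * s0). The
    second is sinh u / exp u = (1 - exp (-2 u)) / 2 at u = \<open>u0\<close>, an increasing function
    of u.\<close>
  define c where "c = min (\<gamma> * exp (- (pi / 2 * s0))) ((1 - exp (- 2 * u0)) / 2)"
  show thesis
  proof (rule that)
    show "0 < c" using \<gamma> u0 by (simp add: c_def)
  next
    fix \<zeta> assume "\<zeta> \<in> strip d"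
    then have y: "\<bar>Im \<zeta>\<bar> < d" by (simp add: strip_def)
    define w where "w = of_real (pi / 2) * sinh \<zeta>"
    have Re_w: "Re w = pi / 2 * sinh (Re \<zeta>) * cos (Im \<zeta>)"
      by (simp add: w_def Re_sinh)
    have Im_w: "Im w = pi / 2 * cosh (Re \<zeta>) * sin (Im \<zeta>)"
      by (simp add: w_def Im_sinh)
    have cosy: "0 < cos (Im \<zeta>)" "cos d \<le> cos (Im \<zeta>)" "\<bar>sin (Im \<zeta>)\<bar> \<le> p"
      using cos_strip[OF d(2) y] by (auto simp: p_def)
    have "c * exp \<bar>Re w\<bar> \<le> norm (cosh w)"
    proof (cases "\<bar>sinh (Re \<zeta>)\<bar> \<le> s0")
      case True
      have "cosh (Re \<zeta>) \<le> 1 + \<bar>sinh (Re \<zeta>)\<bar>"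
        by (rule power2_le_imp_le) (auto simp: cosh_square_eq power2_sum)
      also have "\<dots> \<le> 1 + s0" using True by simp
      finally have "cosh (Re \<zeta>) * \<bar>sin (Im \<zeta>)\<bar> \<le> (1 + s0) * p"
        using cosy s0 by (intro mult_mono) auto
      also have "\<dots> \<le> p + s0" using p s0 by (simp add: algebra_simps)
      also have "\<dots> = (1 + p) / 2" by (simp add: s0_def field_simps)
      finally have "pi / 2 * (cosh (Re \<zeta>) * \<bar>sin (Im \<zeta>)\<bar>) \<le> pi / 2 * ((1 + p) / 2)"
        by (intro mult_left_mono) auto
      then have "\<bar>Im w\<bar> \<le> (1 + p) / 2 * (pi / 2)"
        by (simp add: Im_w abs_mult mult_ac)
      then have "\<gamma> \<le> cos \<bar>Im w\<bar>"
        unfolding \<gamma>_def using p by (intro cos_monotone_0_pi_le) (auto simp: field_simps)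
      then have "\<gamma>\<^sup>2 \<le> (cos (Im w))\<^sup>2" using \<gamma> by (intro power_mono) auto
      also have "\<dots> \<le> (norm (cosh w))\<^sup>2" by (simp add: norm_cosh_squared)
      finally have "\<gamma> \<le> norm (cosh w)" by (rule power2_le_imp_le) simp
      moreover have "\<bar>Re w\<bar> \<le> pi / 2 * s0"
      proof -
        have "\<bar>sinh (Re \<zeta>)\<bar> * \<bar>cos (Im \<zeta>)\<bar> \<le> s0 * 1"
          using True s0 by (intro mult_mono) auto
        then show ?thesis by (simp add: Re_w abs_mult)
      qed
      then have "c * exp \<bar>Re w\<bar> \<le> (\<gamma> * exp (- (pi / 2 * s0))) * exp (pi / 2 * s0)"
        using \<gamma> by (intro mult_mono) (auto simp: c_def)
      moreover have "\<dots> = \<gamma>" by (simp add: exp_minus)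
      ultimately show ?thesis by linarith
    next
      case False
      then have "pi / 2 * s0 * cos d \<le> pi / 2 * \<bar>sinh (Re \<zeta>)\<bar> * cos (Im \<zeta>)"
        using cosy cosd s0 by (intro mult_mono) auto
      then have u: "u0 \<le> \<bar>Re w\<bar>" using cosy by (simp add: u0_def Re_w abs_mult)
      have "(sinh \<bar>Re w\<bar>)\<^sup>2 \<le> (norm (cosh w))\<^sup>2" by (simp add: norm_cosh_squared)
      then have "sinh \<bar>Re w\<bar> \<le> norm (cosh w)" by (rule power2_le_imp_le) simp
      moreover have "c \<le> (1 - exp (- 2 * \<bar>Re w\<bar>)) / 2"
        unfolding c_def using u by (intro order_trans[OF min.cobounded2]) simp
      then have "c * exp \<bar>Re w\<bar> \<le> (1 - exp (- 2 * \<bar>Re w\<bar>)) / 2 * exp \<bar>Re w\<bar>"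
        by (rule mult_right_mono) simp
      moreover have "\<dots> = sinh \<bar>Re w\<bar>"
        by (simp add: sinh_def field_simps flip: exp_add)
      ultimately show ?thesis by linarith
    qed
    then show "c * exp \<bar>pi / 2 * sinh (Re \<zeta>) * cos (Im \<zeta>)\<bar> \<le> norm (cosh (of_real (pi / 2) * sinh \<zeta>))"
      by (simp only: Re_w flip: w_def)
  qed
qed

lemma cosh_sinh_nonzero:
  assumes "0 < d" "d < pi / 2" "\<zeta> \<in> strip d"
  shows "cosh (of_real (pi / 2) * sinh \<zeta>) \<noteq> 0"
proof
  assume *: "cosh (of_real (pi / 2) * sinh \<zeta>) = 0"
  obtain c where "0 < c" "c * exp \<bar>pi / 2 * sinh (Re \<zeta>) * cos (Im \<zeta>)\<bar> \<le> norm (cosh (of_real (pi / 2) * sinh \<zeta>))"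
    using cosh_sinh_lower_bound[OF assms(1,2)] assms(3) by metis
  moreover from \<open>0 < c\<close> have "0 < c * exp \<bar>pi / 2 * sinh (Re \<zeta>) * cos (Im \<zeta>)\<bar>"
    by (intro mult_pos_pos) auto
  ultimately have "0 < norm (cosh (of_real (pi / 2) * sinh \<zeta>))" by linarith
  with * show False by simp
qed

text \<open>As \<open>tanh\<close> and \<open>sinh\<close> are odd, the reflection \<zeta> ->
  -\<zeta> exchanges the roles of \<open>a\<close> and \<open>b\<close>.\<close>

lemma psi_DE_minus: "psi_DE a b (- \<zeta>) = of_real (a + b) - psi_DE a b \<zeta>"
  by (simp add: psi_DE_def field_simps)

lemma psi_DE_minus_left:
  "psi_DE a b \<zeta> - of_real a = of_real ((b - a) / 2) * (1 + tanh (of_real (pi / 2) * sinh \<zeta>))"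
  by (simp add: psi_DE_def field_simps)

lemma right_minus_psi_DE:
  "of_real b - psi_DE a b \<zeta> = of_real ((b - a) / 2) * (1 - tanh (of_real (pi / 2) * sinh \<zeta>))"
  by (simp add: psi_DE_def field_simps)

lemma one_minus_tanh_squared:
  fixes z :: complex
  assumes "cosh z \<noteq> 0"
  shows "1 - (tanh z)\<^sup>2 = 1 / (cosh z)\<^sup>2"
proof -
  have "1 - (tanh z)\<^sup>2 = ((cosh z)\<^sup>2 - (sinh z)\<^sup>2) / (cosh z)\<^sup>2"
    using assms by (simp add: tanh_def power_divide diff_divide_distrib)
  then show ?thesis by (simp only: hyperbolic_pythagoras)
qed

lemma Q_psi_DE:
  "Q a b (psi_DE a b \<zeta>) = (of_real ((b - a) / 2))\<^sup>2 * (1 - (tanh (of_real (pi / 2) * sinh \<zeta>))\<^sup>2)"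
  unfolding Q_def psi_DE_minus_left right_minus_psi_DE by algebra

text \<open>The derivative of \<open>psi_DE\<close>, written with \<open>Q\<close> as a factor so
  that the products in the hypotheses on the coefficients appear without a division.\<close>

definition dpsi_DE :: "real \<Rightarrow> real \<Rightarrow> complex \<Rightarrow> complex" where
  "dpsi_DE a b \<zeta> = Q a b (psi_DE a b \<zeta>) * (of_real (pi / (b - a)) * cosh \<zeta>)"

lemma psi_DE_has_derivative:
  assumes "a < b" "cosh (of_real (pi / 2) * sinh \<zeta>) \<noteq> 0"
  shows "(psi_DE a b has_field_derivative dpsi_DE a b \<zeta>) (at \<zeta>)"
proof -
  have "(psi_DE a b has_field_derivative of_real ((b - a) / 2) *
      ((1 - (tanh (of_real (pi / 2) * sinh \<zeta>))\<^sup>2) * (of_real (pi / 2) * cosh \<zeta>))) (at \<zeta>)"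
    unfolding psi_DE_def [abs_def] using assms(2) by (auto intro!: derivative_eq_intros)
  also have "of_real ((b - a) / 2) * ((1 - (tanh (of_real (pi / 2) * sinh \<zeta>))\<^sup>2) * (of_real (pi / 2) * cosh \<zeta>))
      = dpsi_DE a b \<zeta>"
    unfolding dpsi_DE_def Q_psi_DE using assms(1) by (simp add: field_simps power2_eq_square)
  finally show ?thesis .
qed

lemma norm_Q_psi_DE_le:
  assumes d: "0 < d" "d < pi / 2"
  obtains C where "0 \<le> C"
    and "\<And>\<zeta>. \<zeta> \<in> strip d \<Longrightarrow>
      norm (Q a b (psi_DE a b \<zeta>)) \<le> C * exp (- (2 * \<bar>pi / 2 * sinh (Re \<zeta>) * cos (Im \<zeta>)\<bar>))"
proof -
  obtain c where c: "0 < c" and low: "\<And>\<zeta>. \<zeta> \<in> strip d \<Longrightarrow>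
      c * exp \<bar>pi / 2 * sinh (Re \<zeta>) * cos (Im \<zeta>)\<bar> \<le> norm (cosh (of_real (pi / 2) * sinh \<zeta>))"
    using cosh_sinh_lower_bound[OF d] by metis
  show thesis
  proof (rule that)
    show "0 \<le> ((b - a) / 2)\<^sup>2 / c\<^sup>2" by simp
  next
    fix \<zeta> assume \<zeta>: "\<zeta> \<in> strip d"
    define u where "u = \<bar>pi / 2 * sinh (Re \<zeta>) * cos (Im \<zeta>)\<bar>"
    define w where "w = of_real (pi / 2) * sinh \<zeta>"
    have w0: "cosh w \<noteq> 0"
      unfolding w_def by (rule cosh_sinh_nonzero[OF d \<zeta>])
    have low': "c * exp u \<le> norm (cosh w)"
      using low[OF \<zeta>] by (simp only: u_def w_def)
    have "norm (Q a b (psi_DE a b \<zeta>)) = norm ((of_real ((b - a) / 2))\<^sup>2 * (1 / (cosh w)\<^sup>2))"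
      by (simp only: Q_psi_DE one_minus_tanh_squared[OF w0] flip: w_def)
    also have "\<dots> = ((b - a) / 2)\<^sup>2 / (norm (cosh w))\<^sup>2"
      by (simp only: norm_mult norm_divide norm_power norm_one norm_of_real) (simp add: power_divide)
    also have "\<dots> \<le> ((b - a) / 2)\<^sup>2 / (c * exp u)\<^sup>2"
      using low' c w0 by (intro divide_left_mono power_mono mult_pos_pos zero_less_power) auto
    also have "\<dots> = ((b - a) / 2)\<^sup>2 / c\<^sup>2 * exp (- (2 * u))"
      by (simp add: power_mult_distrib exp_minus field_simps flip: exp_double)
    finally show "norm (Q a b (psi_DE a b \<zeta>)) \<le> ((b - a) / 2)\<^sup>2 / c\<^sup>2 * exp (- (2 * u))" .
  qed
qed

text \<open>The decay of \<open>Q\<close> raised to the power \<alpha> gives exp (- \<bar>v\<bar>)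
  with v = \<alpha> pi cos (Im \<zeta>) sinh (Re \<zeta>). This is at most 1 / cosh v, and the
  factor \<open>cosh \<zeta>\<close> supplies the numerator of \<open>weight\<close>. The rate is
  kept separately on each horizontal line because it must match that of psi - a.\<close>

lemma L_space_times_dpsi_DE:
  assumes "a < b" and d: "0 < d" "d < pi / 2" and \<alpha>: "0 < \<alpha>"
    and k: "(\<lambda>\<zeta>. k \<zeta> * Q a b (psi_DE a b \<zeta>)) \<in> L_space a b d \<alpha>"
  shows "(\<lambda>\<zeta>. k \<zeta> * dpsi_DE a b \<zeta>) holomorphic_on strip d"
    and "\<exists>L. \<forall>\<zeta>\<in>strip d. norm (k \<zeta> * dpsi_DE a b \<zeta>) \<le> L * weight (\<alpha> * pi * cos (Im \<zeta>)) (Re \<zeta>)"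
proof -
  have "(\<lambda>\<zeta>. k \<zeta> * Q a b (psi_DE a b \<zeta>)) holomorphic_on strip d"
    using k by (auto simp: L_space_def H_inf_def intro: analytic_imp_holomorphic)
  moreover have "(\<lambda>\<zeta>. of_real (pi / (b - a)) * cosh \<zeta>) holomorphic_on strip d"
    unfolding cosh_def by (intro holomorphic_intros)
  ultimately have "(\<lambda>\<zeta>. k \<zeta> * Q a b (psi_DE a b \<zeta>) * (of_real (pi / (b - a)) * cosh \<zeta>)) holomorphic_on strip d"
    by (rule holomorphic_on_mult)
  then show "(\<lambda>\<zeta>. k \<zeta> * dpsi_DE a b \<zeta>) holomorphic_on strip d"
    by (simp add: dpsi_DE_def mult.assoc)
next
  obtain L where L: "\<And>\<zeta>. \<zeta> \<in> strip d \<Longrightarrow>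
      norm (k \<zeta> * Q a b (psi_DE a b \<zeta>)) \<le> L * norm (Q a b (psi_DE a b \<zeta>)) powr \<alpha>"
    using k by (auto simp: L_space_def)
  obtain C where C: "0 \<le> C" and Q_le: "\<And>\<zeta>. \<zeta> \<in> strip d \<Longrightarrow>
      norm (Q a b (psi_DE a b \<zeta>)) \<le> C * exp (- (2 * \<bar>pi / 2 * sinh (Re \<zeta>) * cos (Im \<zeta>)\<bar>))"
    using norm_Q_psi_DE_le[OF d] by metis
  have "norm (k \<zeta> * dpsi_DE a b \<zeta>) \<le>
      \<bar>L\<bar> * C powr \<alpha> * (pi / (b - a)) * weight (\<alpha> * pi * cos (Im \<zeta>)) (Re \<zeta>)"
    if \<zeta>: "\<zeta> \<in> strip d" for \<zeta>
  proof -
    define u where "u = \<bar>pi / 2 * sinh (Re \<zeta>) * cos (Im \<zeta>)\<bar>"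
    define v where "v = \<alpha> * pi * cos (Im \<zeta>) * sinh (Re \<zeta>)"
    have uv: "2 * u * \<alpha> = \<bar>v\<bar>" using \<alpha> by (simp add: u_def v_def abs_mult)
    have "norm (k \<zeta> * Q a b (psi_DE a b \<zeta>)) \<le> \<bar>L\<bar> * norm (Q a b (psi_DE a b \<zeta>)) powr \<alpha>"
      using L[OF \<zeta>] by (rule order_trans) (auto intro: mult_right_mono)
    also have "\<dots> \<le> \<bar>L\<bar> * (C * exp (- (2 * u))) powr \<alpha>"
      unfolding u_def using \<alpha> by (intro mult_left_mono powr_mono2 Q_le \<zeta>) auto
    also have "(C * exp (- (2 * u))) powr \<alpha> = C powr \<alpha> * exp (- \<bar>v\<bar>)"
      using C by (simp add: powr_mult exp_powr_real flip: uv)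
    also have "exp (- \<bar>v\<bar>) \<le> 1 / cosh v"
      using cosh_real_le_exp_abs[of v] by (simp add: exp_minus field_simps)
    finally have "norm (k \<zeta> * Q a b (psi_DE a b \<zeta>)) \<le> \<bar>L\<bar> * (C powr \<alpha> * (1 / cosh v))"
      by (simp add: mult_left_mono)
    then have "norm (k \<zeta> * Q a b (psi_DE a b \<zeta>)) * (pi / (b - a) * norm (cosh \<zeta>))
        \<le> (\<bar>L\<bar> * (C powr \<alpha> * (1 / cosh v))) * (pi / (b - a) * cosh (Re \<zeta>))"
      using \<open>a < b\<close> norm_cosh_le by (intro mult_mono) auto
    moreover have "norm (of_real (pi / (b - a)) :: complex) = pi / (b - a)"
      using \<open>a < b\<close> by (simp only: norm_of_real) simp
    then have "norm (k \<zeta> * dpsi_DE a b \<zeta>) =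
        norm (k \<zeta> * Q a b (psi_DE a b \<zeta>)) * (pi / (b - a) * norm (cosh \<zeta>))"
      by (simp only: dpsi_DE_def norm_mult mult.assoc)
    ultimately show ?thesis
      by (simp add: weight_def v_def mult_ac)
  qed
  then show "\<exists>L. \<forall>\<zeta>\<in>strip d. norm (k \<zeta> * dpsi_DE a b \<zeta>) \<le> L * weight (\<alpha> * pi * cos (Im \<zeta>)) (Re \<zeta>)"
    by blast
qed

text \<open>With w = (pi / 2) sinh \<zeta> and u = Re w, the modulus of psi - a is (b - a) / 2 * exp
  u / \<bar>cosh w\<bar>, hence at least (b - a) / 2 * exp (u - \<bar>u\<bar>). Since \<kappa> sinh
  (Re \<zeta>) = 2 \<alpha> u, the decay of \<open>weight_prim\<close> has exactly the exponent
  \<alpha> times that of this lower bound.\<close>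

lemma weight_prim_le_psi_DE:
  assumes "a < b" and d: "0 < d" "d < pi / 2" and \<alpha>: "0 < \<alpha>" and \<zeta>: "\<zeta> \<in> strip d"
  shows "weight_prim (\<alpha> * pi * cos (Im \<zeta>)) (Re \<zeta>) \<le>
    1 / (\<alpha> * cos d * ((b - a) / 2) powr \<alpha>) * norm (psi_DE a b \<zeta> - of_real a) powr \<alpha>"
proof -
  define \<kappa> where "\<kappa> = \<alpha> * pi * cos (Im \<zeta>)"
  define w where "w = of_real (pi / 2) * sinh \<zeta>"
  define u where "u = Re w"
  have cosy: "0 < cos d" "cos d \<le> cos (Im \<zeta>)"
    using cos_strip[OF d(2), of "Im \<zeta>"] \<zeta> by (auto simp: strip_def)
  have \<kappa>: "0 < \<kappa>" "\<alpha> * pi * cos d \<le> \<kappa>" using \<alpha> cosy by (auto simp: \<kappa>_def)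
  have u: "2 * (\<alpha> * u) = \<kappa> * sinh (Re \<zeta>)" by (simp add: u_def w_def \<kappa>_def Re_sinh)
  have w0: "cosh w \<noteq> 0" using cosh_sinh_nonzero[OF d \<zeta>] by (simp add: w_def)
  \<comment> \<open>The exponent u - \<bar>u\<bar> is 2 u for u \<le> 0 and 0 otherwise, so one
    expression covers both exponential decay on the left and boundedness on the right.\<close>
  have "weight_prim \<kappa> (Re \<zeta>) \<le> pi / \<kappa> * exp (\<alpha> * (u - \<bar>u\<bar>))"
  proof (cases "u \<le> 0")
    case True
    have "weight_prim \<kappa> (Re \<zeta>) \<le> 2 / \<kappa> * exp (\<kappa> * sinh (Re \<zeta>))"
      using weight_prim_le_exp \<kappa> by blast
    also have "\<dots> \<le> pi / \<kappa> * exp (\<kappa> * sinh (Re \<zeta>))"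
      using \<kappa> pi_ge_two by (intro mult_right_mono divide_right_mono) auto
    finally have "weight_prim \<kappa> (Re \<zeta>) \<le> pi / \<kappa> * exp (\<kappa> * sinh (Re \<zeta>))" .
    moreover have "\<alpha> * (u - \<bar>u\<bar>) = \<kappa> * sinh (Re \<zeta>)" using True u by simp
    ultimately show ?thesis by simp
  next
    case False
    then show ?thesis using weight_prim_less[OF \<kappa>(1), of "Re \<zeta>"] by simp
  qed
  also have "\<dots> \<le> pi / (\<alpha> * pi * cos d) * exp (\<alpha> * (u - \<bar>u\<bar>))"
    using \<kappa> \<alpha> cosy by (intro mult_right_mono divide_left_mono) auto
  also have "\<dots> = 1 / (\<alpha> * cos d * ((b - a) / 2) powr \<alpha>) * ((b - a) / 2 * exp (u - \<bar>u\<bar>)) powr \<alpha>"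
  proof -
    have "((b - a) / 2 * exp (u - \<bar>u\<bar>)) powr \<alpha> = ((b - a) / 2) powr \<alpha> * exp (\<alpha> * (u - \<bar>u\<bar>))"
      using \<open>a < b\<close> by (subst powr_mult) (auto simp: exp_powr_real mult.commute)
    then show ?thesis using \<open>a < b\<close> \<alpha> cosy by (simp only:) simp
  qed
  also have "\<dots> \<le> 1 / (\<alpha> * cos d * ((b - a) / 2) powr \<alpha>) * norm (psi_DE a b \<zeta> - of_real a) powr \<alpha>"
  proof (intro mult_left_mono powr_mono2)
    have "1 + tanh w = exp w / cosh w"
      using w0 by (simp add: tanh_def field_simps flip: cosh_plus_sinh)
    then have norm_eq: "norm (psi_DE a b \<zeta> - of_real a) = (b - a) / 2 * (exp u / norm (cosh w))"
      unfolding psi_DE_minus_left w_def [symmetric] using \<open>a < b\<close>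
      by (simp only: norm_mult norm_divide norm_of_real norm_exp_eq_Re u_def) simp
    have le: "exp (u - \<bar>u\<bar>) \<le> exp u / norm (cosh w)"
      unfolding exp_diff
      using norm_cosh_le[of w] cosh_real_le_exp_abs[of u] w0
      by (intro divide_left_mono) (auto simp: u_def)
    have "(b - a) / 2 * exp (u - \<bar>u\<bar>) \<le> (b - a) / 2 * (exp u / norm (cosh w))"
      using \<open>a < b\<close> by (intro mult_left_mono le) simp
    then show "(b - a) / 2 * exp (u - \<bar>u\<bar>) \<le> norm (psi_DE a b \<zeta> - of_real a)"
      by (simp only: norm_eq)
  qed (use \<open>a < b\<close> \<alpha> cosy in auto)
  finally show ?thesis by (simp add: \<kappa>_def)
qed

lemma DERIV_reflect:
  assumes "(F has_field_derivative f) (at (- \<zeta>))"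
  shows "((\<lambda>\<zeta>. F (- \<zeta>)) has_field_derivative - f) (at \<zeta>)"
proof -
  have "(uminus has_field_derivative - 1) (at \<zeta>)"
    by (auto intro!: derivative_eq_intros)
  from DERIV_chain2[where f = F and g = uminus, OF assms this] show ?thesis by simp
qed

text \<open>The uniform rate \<kappa> yields the limits and boundedness; the rate of the individual
  line yields the power of \<bar>psi - a\<bar>. The right end follows by reflection.\<close>

lemma M_space_of_derivative_bound:
  assumes "a < b" and d: "0 < d" "d < pi / 2" and \<alpha>: "0 < \<alpha>"
    and F: "\<And>\<zeta>. \<zeta> \<in> strip d \<Longrightarrow> (F has_field_derivative f \<zeta>) (at \<zeta>)"
    and le: "\<And>\<zeta>. \<zeta> \<in> strip d \<Longrightarrow> norm (f \<zeta>) \<le> C * weight (\<alpha> * pi * cos (Im \<zeta>)) (Re \<zeta>)"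
  shows "F \<in> M_space a b d \<alpha>"
proof -
  have C: "0 \<le> C"
    using le[of 0] d(1) norm_ge_zero[of "f 0"]
    by (metis Complex_in_strip_iff abs_zero order_trans weight_pos zero_complex.code zero_le_mult_iff not_le)
  define \<kappa> where "\<kappa> = \<alpha> * pi * cos d"
  have "0 < cos d" using d by (intro cos_gt_zero) auto
  then have \<kappa>: "0 < \<kappa>" using \<alpha> by (simp add: \<kappa>_def)
  have \<kappa>_le: "\<kappa> \<le> \<alpha> * pi * cos (Im \<zeta>)" if "\<zeta> \<in> strip d" for \<zeta>
    using that cos_strip(2)[OF d(2), of "Im \<zeta>"] \<alpha> by (auto simp: \<kappa>_def strip_def)
  have lim: "\<exists>l. (G \<longlongrightarrow> l) (left_end d)"
    if "\<And>\<zeta>. \<zeta> \<in> strip d \<Longrightarrow> (G has_field_derivative g \<zeta>) (at \<zeta>)"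
      "\<And>\<zeta>. \<zeta> \<in> strip d \<Longrightarrow> norm (g \<zeta>) \<le> C * weight (\<alpha> * pi * cos (Im \<zeta>)) (Re \<zeta>)" for G g
  proof -
    have "norm (g \<zeta>) \<le> C * weight \<kappa> (Re \<zeta>)" if "\<zeta> \<in> strip d" for \<zeta>
      using \<open>\<zeta> \<in> strip d \<Longrightarrow> norm (g \<zeta>) \<le> _\<close>[OF that]
      by (rule order_trans) (use \<kappa> \<kappa>_le[OF that] C in \<open>auto intro!: mult_left_mono weight_antimono\<close>)
    then show ?thesis
      using left_end_limit_exists[OF that(1) d(1) \<kappa> C] by metis
  qed
  define M where "M = C * (1 / (\<alpha> * cos d * ((b - a) / 2) powr \<alpha>))"
  have bound: "norm (G \<zeta> - l) \<le> C * (pi / \<kappa>)"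
    "norm (G \<zeta> - l) \<le> M * norm (psi_DE a b \<zeta> - of_real a) powr \<alpha>"
    if G: "\<And>\<zeta>. \<zeta> \<in> strip d \<Longrightarrow> (G has_field_derivative g \<zeta>) (at \<zeta>)"
      "\<And>\<zeta>. \<zeta> \<in> strip d \<Longrightarrow> norm (g \<zeta>) \<le> C * weight (\<alpha> * pi * cos (Im \<zeta>)) (Re \<zeta>)"
      and l: "(G \<longlongrightarrow> l) (left_end d)" and \<zeta>: "\<zeta> \<in> strip d" for G g l \<zeta>
  proof -
    have pos: "0 < \<alpha> * pi * cos (Im \<zeta>)" using \<kappa> \<kappa>_le[OF \<zeta>] by linarith
    have *: "norm (G \<zeta> - l) \<le> C * weight_prim (\<alpha> * pi * cos (Im \<zeta>)) (Re \<zeta>)"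
      using G(2)[OF Complex_Re_in_strip[OF \<zeta>]]
      by (intro weight_bound_left_end[OF G(1) l \<zeta> pos]) auto
    also have "\<dots> \<le> C * (pi / (\<alpha> * pi * cos (Im \<zeta>)))"
      using C less_imp_le[OF weight_prim_less[OF pos]] by (intro mult_left_mono)
    also have "\<dots> \<le> C * (pi / \<kappa>)"
      using C \<kappa> \<kappa>_le[OF \<zeta>] pos by (intro mult_left_mono divide_left_mono) auto
    finally show "norm (G \<zeta> - l) \<le> C * (pi / \<kappa>)" .
    have "C * weight_prim (\<alpha> * pi * cos (Im \<zeta>)) (Re \<zeta>) \<le> M * norm (psi_DE a b \<zeta> - of_real a) powr \<alpha>"
      unfolding M_def mult.assoc
      using mult_left_mono[OF weight_prim_le_psi_DE[OF \<open>a < b\<close> d \<alpha> \<zeta>] C] by (simp add: mult.assoc)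
    with * show "norm (G \<zeta> - l) \<le> M * norm (psi_DE a b \<zeta> - of_real a) powr \<alpha>" by linarith
  qed
  \<comment> \<open>The reflected function obeys the same derivative bound, because
    \<open>weight\<close> is even in the real part and cos is even in the imaginary part.\<close>
  define G where "G \<zeta> = F (- \<zeta>)" for \<zeta>
  have G: "(G has_field_derivative - f (- \<zeta>)) (at \<zeta>)" if "\<zeta> \<in> strip d" for \<zeta>
    unfolding G_def using F[of "- \<zeta>"] that by (intro DERIV_reflect) simp
  have g: "norm (- f (- \<zeta>)) \<le> C * weight (\<alpha> * pi * cos (Im \<zeta>)) (Re \<zeta>)" if "\<zeta> \<in> strip d" for \<zeta>
    using le[of "- \<zeta>"] that by simp
  obtain fa where fa: "(F \<longlongrightarrow> fa) (left_end d)" using lim[OF F le] by blast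
  obtain fb where fb: "(G \<longlongrightarrow> fb) (left_end d)" using lim[OF G g] by blast
  have fb': "(F \<longlongrightarrow> fb) (right_end d)"
    using filterlim_compose[OF fb filterlim_uminus_right_end] by (simp add: G_def)
  have right: "norm (fb - F \<zeta>) \<le> M * norm (of_real b - psi_DE a b \<zeta>) powr \<alpha>" if \<zeta>: "\<zeta> \<in> strip d" for \<zeta>
  proof -
    have "psi_DE a b (- \<zeta>) - of_real a = of_real b - psi_DE a b \<zeta>"
      by (simp add: psi_DE_minus)
    with bound(2)[OF G g fb, of "- \<zeta>"] \<zeta> show ?thesis
      by (simp add: G_def norm_minus_commute)
  qed
  have "F holomorphic_on strip d" using F by (auto simp: holomorphic_on_open)
  then have "F analytic_on strip d" by (simp add: analytic_on_open)
  moreover have "norm (F \<zeta>) \<le> norm fa + C * (pi / \<kappa>)" if "\<zeta> \<in> strip d" for \<zeta>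
    using norm_triangle_sub[of "F \<zeta>" fa] bound(1)[OF F le fa that] by linarith
  then have "bounded (F ` strip d)" by (auto simp: bounded_iff)
  ultimately show ?thesis
    unfolding M_space_def H_inf_def using fa fb' bound(2)[OF F le fa] right by blast
qed

subsection \<open>Restriction to the interval\<close>

text \<open>Closed form of the real preimage that \<open>on_interval\<close> selects; it has this
  meaning only for a < t < b.\<close>

definition inv_psi_DE :: "real \<Rightarrow> real \<Rightarrow> real \<Rightarrow> real" where
  "inv_psi_DE a b t = arsinh (2 / pi * artanh ((2 * t - a - b) / (b - a)))"

definition real_psi_DE :: "real \<Rightarrow> real \<Rightarrow> real \<Rightarrow> real" where
  "real_psi_DE a b x = (b - a) / 2 * tanh (pi / 2 * sinh x) + (b + a) / 2"

definition real_dpsi_DE :: "real \<Rightarrow> real \<Rightarrow> real \<Rightarrow> real" where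
  "real_dpsi_DE a b x = (b - a) / 2 * ((1 - (tanh (pi / 2 * sinh x))\<^sup>2) * (pi / 2 * cosh x))"

lemma real_psi_DE_inv:
  assumes "a < t" "t < b"
  shows "real_psi_DE a b (inv_psi_DE a b t) = t"
proof -
  have "\<bar>(2 * t - a - b) / (b - a)\<bar> < 1" using assms by (simp add: abs_if field_simps)
  then show ?thesis
    using assms by (simp add: real_psi_DE_def inv_psi_DE_def sinh_arsinh_real tanh_artanh_real field_simps)
qed

lemma real_psi_DE_strict_mono: "a < b \<Longrightarrow> x < y \<Longrightarrow> real_psi_DE a b x < real_psi_DE a b y"
  by (simp add: real_psi_DE_def)

lemma real_psi_DE_bounds:
  assumes "a < b"
  shows "a < real_psi_DE a b x" "real_psi_DE a b x < b"
proof -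
  have "(b - a) / 2 * - 1 < (b - a) / 2 * tanh (pi / 2 * sinh x)"
    using assms by (intro mult_strict_left_mono tanh_real_gt_neg1) auto
  then show "a < real_psi_DE a b x" by (simp add: real_psi_DE_def field_simps)
  have "(b - a) / 2 * tanh (pi / 2 * sinh x) < (b - a) / 2 * 1"
    using assms by (intro mult_strict_left_mono tanh_real_lt_1) auto
  then show "real_psi_DE a b x < b" by (simp add: real_psi_DE_def field_simps)
qed

lemma on_interval_eq:
  assumes "a < t" "t < b"
  shows "on_interval a b F t = F (of_real (inv_psi_DE a b t))"
proof -
  have "psi_DE a b (of_real (inv_psi_DE a b t)) = of_real t"
    using real_psi_DE_inv[OF assms] by (simp add: psi_DE_of_real real_psi_DE_def)
  with psi_DE_ex1[OF assms]
  have "(THE x. psi_DE a b (of_real x) = of_real t) = inv_psi_DE a b t"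
    by (rule the1_equality)
  then show ?thesis by (simp add: on_interval_def)
qed

lemma DERIV_real_psi_DE: "(real_psi_DE a b has_real_derivative real_dpsi_DE a b x) (at x)"
  unfolding real_psi_DE_def [abs_def] real_dpsi_DE_def
  by (auto intro!: derivative_eq_intros)

lemma real_dpsi_DE_pos:
  assumes "a < b"
  shows "0 < real_dpsi_DE a b x"
proof -
  have "(tanh (pi / 2 * sinh x))\<^sup>2 < 1"
    using tanh_real_bounds[of "pi / 2 * sinh x"] by (simp add: abs_square_less_1 abs_if)
  then show ?thesis using assms by (simp add: real_dpsi_DE_def)
qed

text \<open>Both sides are derivatives of \<open>psi_DE\<close> along the real axis, so uniqueness
  of the derivative identifies them.\<close>

lemma dpsi_DE_of_real:
  assumes "a < b"
  shows "dpsi_DE a b (of_real x) = of_real (real_dpsi_DE a b x)"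
proof -
  \<comment> \<open>The half-width 1 of the auxiliary strip is an arbitrary choice below pi /
    2.\<close>
  have "((\<lambda>x. psi_DE a b (Complex x 0)) has_vector_derivative dpsi_DE a b (Complex x 0)) (at x)"
    by (intro has_vector_derivative_Complex_line psi_DE_has_derivative[OF assms]
        cosh_sinh_nonzero[of 1]) (use pi_gt3 in auto)
  then have "((\<lambda>x. psi_DE a b (of_real x)) has_vector_derivative dpsi_DE a b (of_real x)) (at x)"
    by (simp add: complex_of_real_def)
  moreover have "((\<lambda>x. psi_DE a b (of_real x)) has_vector_derivative of_real (real_dpsi_DE a b x)) (at x)"
    unfolding psi_DE_of_real real_psi_DE_def [symmetric]
    using DERIV_real_psi_DE by (auto intro!: derivative_eq_intros)
  ultimately show ?thesis by (rule vector_derivative_unique_at)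
qed

lemma DERIV_inv_psi_DE:
  assumes "a < t" "t < b"
  shows "(inv_psi_DE a b has_real_derivative inverse (real_dpsi_DE a b (inv_psi_DE a b t))) (at t)"
proof (rule DERIV_inverse_function[OF DERIV_real_psi_DE _ assms])
  show "real_dpsi_DE a b (inv_psi_DE a b t) \<noteq> 0"
    using real_dpsi_DE_pos[of a b] assms by (metis less_irrefl less_trans)
  show "real_psi_DE a b (inv_psi_DE a b s) = s" if "a < s" "s < b" for s
    using real_psi_DE_inv that .
  have "continuous_on {a<..<b} (inv_psi_DE a b)"
    unfolding inv_psi_DE_def [abs_def] using assms
    by (intro continuous_intros) (auto simp: field_simps)
  then show "isCont (inv_psi_DE a b) t"
    using assms by (simp add: continuous_on_eq_continuous_at)
qed

lemma filterlim_inv_psi_DE_at_right: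
  assumes "a < b"
  shows "filterlim (inv_psi_DE a b) at_bot (at_right a)"
  unfolding filterlim_at_bot
proof
  fix Z
  show "\<forall>\<^sub>F t in at_right a. inv_psi_DE a b t \<le> Z"
  proof (rule eventually_at_rightI)
    fix t assume "t \<in> {a<..<real_psi_DE a b Z}"
    then show "inv_psi_DE a b t \<le> Z"
      using real_psi_DE_inv[of a t b] real_psi_DE_bounds[OF assms, of Z]
        real_psi_DE_strict_mono[OF assms, of Z "inv_psi_DE a b t"] by force
  qed (rule real_psi_DE_bounds[OF assms])
qed

lemma filterlim_inv_psi_DE_at_left:
  assumes "a < b"
  shows "filterlim (inv_psi_DE a b) at_top (at_left b)"
  unfolding filterlim_at_top
proof
  fix Z
  show "\<forall>\<^sub>F t in at_left b. Z \<le> inv_psi_DE a b t"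
  proof (rule eventually_at_leftI)
    fix t assume "t \<in> {real_psi_DE a b Z<..<b}"
    then show "Z \<le> inv_psi_DE a b t"
      using real_psi_DE_inv[of a t b] real_psi_DE_bounds[OF assms, of Z]
        real_psi_DE_strict_mono[OF assms, of "inv_psi_DE a b t" Z] by force
  qed (rule real_psi_DE_bounds[OF assms])
qed

text \<open>Composition with the inverse of \<open>psi_DE\<close> turns limits at -infinity and
  infinity into continuous boundary values, while the derivative may blow up there. It serves both
  the solution and the majorant \<open>weight_prim\<close>.\<close>

lemma interval_extension:
  fixes u :: "real \<Rightarrow> 'a::real_normed_vector"
  assumes "a < b" and u: "\<And>x. (u has_vector_derivative u' x) (at x)"
    and l: "(u \<longlongrightarrow> l) at_bot" and m: "(u \<longlongrightarrow> m) at_top"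
  obtains v where "continuous_on {a..b} v" "v a = l" "v b = m"
    and "\<And>t. a < t \<Longrightarrow> t < b \<Longrightarrow> v t = u (inv_psi_DE a b t)"
    and "\<And>t. a < t \<Longrightarrow> t < b \<Longrightarrow>
      (v has_vector_derivative u' (inv_psi_DE a b t) /\<^sub>R real_dpsi_DE a b (inv_psi_DE a b t)) (at t)"
proof -
  define v where "v t = (if t \<le> a then l else if b \<le> t then m else u (inv_psi_DE a b t))" for t
  have deriv: "(v has_vector_derivative u' (inv_psi_DE a b t) /\<^sub>R real_dpsi_DE a b (inv_psi_DE a b t)) (at t)"
    if "a < t" "t < b" for t
  proof (rule has_vector_derivative_transform_within_open)
    show "((u \<circ> inv_psi_DE a b) has_vector_derivative
        u' (inv_psi_DE a b t) /\<^sub>R real_dpsi_DE a b (inv_psi_DE a b t)) (at t)"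
      using DERIV_inv_psi_DE[OF that] u
      by (intro vector_diff_chain_at) (simp_all add: has_real_derivative_iff_has_vector_derivative)
    show "(u \<circ> inv_psi_DE a b) s = v s" if "s \<in> {a<..<b}" for s
      using that by (simp add: v_def)
  qed (use that in auto)
  show thesis
  proof (rule that[OF _ _ _ _ deriv])
    show "continuous_on {a..b} v"
    proof (rule continuous_on_IccI)
      have "\<forall>\<^sub>F t in at_right a. u (inv_psi_DE a b t) = v t"
        using \<open>a < b\<close> by (intro eventually_at_rightI[of a b]) (auto simp: v_def)
      moreover have "((\<lambda>t. u (inv_psi_DE a b t)) \<longlongrightarrow> v a) (at_right a)"
        using filterlim_compose[OF l filterlim_inv_psi_DE_at_right[OF \<open>a < b\<close>]] by (simp add: v_def)
      ultimately show "(v \<longlongrightarrow> v a) (at_right a)"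
        by (rule Lim_transform_eventually[rotated])
      have "\<forall>\<^sub>F t in at_left b. u (inv_psi_DE a b t) = v t"
        using \<open>a < b\<close> by (intro eventually_at_leftI[of a b]) (auto simp: v_def)
      moreover have "((\<lambda>t. u (inv_psi_DE a b t)) \<longlongrightarrow> v b) (at_left b)"
        using filterlim_compose[OF m filterlim_inv_psi_DE_at_left[OF \<open>a < b\<close>]] \<open>a < b\<close>
        by (simp add: v_def)
      ultimately show "(v \<longlongrightarrow> v b) (at_left b)"
        by (rule Lim_transform_eventually[rotated])
      show "v \<midarrow>t\<rightarrow> v t" if "a < t" "t < b" for t
        using has_vector_derivative_continuous[OF deriv[OF that]] by (simp add: continuous_at)
    qed fact
  qed (use \<open>a < b\<close> in \<open>auto simp: v_def\<close>)
qed

lemma norm_vec_le_sum: "norm (x :: 'a::real_normed_vector ^ 'n) \<le> (\<Sum>i\<in>UNIV. norm (x $ i))"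
  by (simp add: norm_vec_def L2_set_le_sum)

lemma norm_matrix_vector_mult_le:
  fixes M :: "'a::real_normed_field ^ 'n ^ 'm"
  shows "norm (M *v v) \<le> (\<Sum>i\<in>UNIV. \<Sum>j\<in>UNIV. norm (M $ i $ j)) * norm v"
proof -
  have "norm ((M *v v) $ i) \<le> (\<Sum>j\<in>UNIV. norm (M $ i $ j) * norm v)" for i
    unfolding matrix_vector_mult_def
    by (auto intro!: sum_norm_le mult_left_mono Finite_Cartesian_Product.norm_nth_le simp: norm_mult)
  then have "(\<Sum>i\<in>UNIV. norm ((M *v v) $ i)) \<le> (\<Sum>i\<in>UNIV. \<Sum>j\<in>UNIV. norm (M $ i $ j) * norm v)"
    by (intro sum_mono)
  with norm_vec_le_sum[of "M *v v"] show ?thesis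
    by (simp add: sum_distrib_right)
qed

lemma has_vector_derivative_vec_lambda:
  fixes f :: "'n::finite \<Rightarrow> real \<Rightarrow> 'a::real_normed_vector"
  assumes "\<And>i. (f i has_vector_derivative f' i) (at x)"
  shows "((\<lambda>x. \<chi> i. f i x) has_vector_derivative (\<chi> i. f' i)) (at x)"
proof -
  have "((\<lambda>t. ((\<chi> i. f i t) - (\<chi> i. f i x) - (t - x) *\<^sub>R (\<chi> i. f' i)) /\<^sub>R norm (t - x)) \<longlongrightarrow> 0) (at x)"
  proof (rule vec_tendstoI)
    fix i
    have "((\<lambda>t. (f i t - f i x - (t - x) *\<^sub>R f' i) /\<^sub>R norm (t - x)) \<longlongrightarrow> 0) (at x)"
      using assms [of i] unfolding has_vector_derivative_def has_derivative_at_within by blast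
    then show "((\<lambda>t. (((\<chi> i. f i t) - (\<chi> i. f i x) - (t - x) *\<^sub>R (\<chi> i. f' i)) /\<^sub>R norm (t - x)) $ i) \<longlongrightarrow> 0 $ i) (at x)"
      by (simp only: vector_scaleR_component vector_minus_component vec_lambda_beta zero_index)
  qed
  then show ?thesis
    unfolding has_vector_derivative_def has_derivative_at_within
    by (intro conjI bounded_linear_scaleR_left)
qed

text \<open>A form of Gronwall's lemma in which \<open>H'\<close>, the majorant of the kernel, may be singular at the end points.\<close>

lemma integral_eq_zero_of_Gronwall:
  fixes w :: "real \<Rightarrow> 'a::euclidean_space"
  assumes "a < b" and w: "continuous_on {a..b} w" and f: "f integrable_on {a..b}"
    and w_eq: "\<And>t. t \<in> {a..b} \<Longrightarrow> w t = integral {a..t} f"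
    and H: "continuous_on {a..b} H"
    and H': "\<And>t. a < t \<Longrightarrow> t < b \<Longrightarrow> (H has_real_derivative H' t) (at t)"
    and H'_nonneg: "\<And>t. a < t \<Longrightarrow> t < b \<Longrightarrow> 0 \<le> H' t"
    and le: "\<And>t. a < t \<Longrightarrow> t < b \<Longrightarrow> norm (f t) \<le> H' t * norm (w t)"
    and t: "t \<in> {a..b}"
  shows "w t = 0"
proof -
  \<comment> \<open>At a maximum of the weighted norm, integrating H' exp (2 H) produces exp (2 H) /
    2. Hence \<bar>w t0\<bar> \<le> \<bar>w t0\<bar> / 2, and the maximum is 0.\<close>
  obtain t0 where t0: "t0 \<in> {a..b}"
    and max: "\<And>t. t \<in> {a..b} \<Longrightarrow> norm (w t) * exp (- (2 * H t)) \<le> norm (w t0) * exp (- (2 * H t0))"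
    using continuous_attains_sup[of "{a..b}" "\<lambda>t. norm (w t) * exp (- (2 * H t))"] \<open>a < b\<close> w H
    by (force intro!: continuous_intros)
  define \<mu> where "\<mu> = norm (w t0) * exp (- (2 * H t0))"
  have w_le: "norm (w t) \<le> \<mu> * exp (2 * H t)" if "t \<in> {a..b}" for t
    using max[OF that] by (simp add: \<mu>_def exp_minus field_simps)
  have \<mu>: "0 \<le> \<mu>" by (simp add: \<mu>_def)
  \<comment> \<open>Nothing is known of \<open>H'\<close> at the end points, so \<open>G\<close>
    takes the value \<open>norm (f s)\<close> there to keep the pointwise bound.\<close>
  define G where "G s = (if a < s \<and> s < b then \<mu> * (H' s * exp (2 * H s)) else norm (f s))" for s
  have G: "(G has_integral \<mu> / 2 * exp (2 * H t0) - \<mu> / 2 * exp (2 * H a)) {a..t0}"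
  proof (rule fundamental_theorem_of_calculus_interior)
    show "continuous_on {a..t0} (\<lambda>s. \<mu> / 2 * exp (2 * H s))"
      using t0 by (intro continuous_intros continuous_on_subset[OF H]) auto
    show "((\<lambda>s. \<mu> / 2 * exp (2 * H s)) has_vector_derivative G s) (at s)" if "s \<in> {a<..<t0}" for s
      unfolding has_real_derivative_iff_has_vector_derivative[symmetric]
      using that t0 H'[of s] by (auto intro!: derivative_eq_intros simp: G_def)
  qed (use t0 in auto)
  have "norm (w t0) = norm (integral {a..t0} f)" using w_eq[OF t0] by simp
  also have "\<dots> \<le> integral {a..t0} G"
  proof (rule integral_norm_bound_integral)
    show "f integrable_on {a..t0}" by (rule integrable_on_subinterval[OF f]) (use t0 in auto)
    show "G integrable_on {a..t0}" using G by blast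
    fix s assume s: "s \<in> {a..t0}"
    show "norm (f s) \<le> G s"
    proof (cases "a < s \<and> s < b")
      case True
      then have "norm (f s) \<le> H' s * (\<mu> * exp (2 * H s))"
        using order_trans[OF le mult_left_mono[OF w_le H'_nonneg]] by auto
      then show ?thesis using True by (simp add: G_def mult_ac)
    qed (auto simp: G_def)
  qed
  also have "\<dots> = \<mu> / 2 * exp (2 * H t0) - \<mu> / 2 * exp (2 * H a)"
    using G by (rule integral_unique)
  also have "\<dots> \<le> \<mu> / 2 * exp (2 * H t0)" using \<mu> by simp
  also have "\<dots> = norm (w t0) / 2" by (simp add: \<mu>_def exp_minus)
  finally have "\<mu> = 0" by (simp add: \<mu>_def)
  with w_le[OF t] show ?thesis by simp
qed

subsection \<open>The initial value problem\<close>

theorem theorem7: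
  fixes a b d \<alpha> :: real
    and K :: "complex \<Rightarrow> complex^'n^'n"
    and g :: "complex \<Rightarrow> complex^'n"
    and r :: "complex^'n"
  assumes "a < b" and "0 < d" and "d < pi / 2" and "0 < \<alpha>" and "\<alpha> \<le> 1"
    and "\<And>i j. (\<lambda>\<zeta>. K \<zeta> $ i $ j * Q a b (psi_DE a b \<zeta>)) \<in> L_space a b d \<alpha>"
    and "\<And>i. (\<lambda>\<zeta>. g \<zeta> $ i * Q a b (psi_DE a b \<zeta>)) \<in> L_space a b d \<alpha>"
  shows "\<exists>y. ivp_solution a b K g r y
           \<and> (\<forall>z. ivp_solution a b K g r z \<longrightarrow> (\<forall>t\<in>{a..b}. z t = y t))
           \<and> (\<forall>i. (\<lambda>t. y t $ i) \<in> interval_M_space a b d \<alpha>)"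
proof -

  \<comment> \<open>Bounds for the coefficients on the strip\<close>
  note ab = \<open>a < b\<close> and d = \<open>0 < d\<close> \<open>d < pi / 2\<close> and \<alpha> = \<open>0 < \<alpha>\<close>
  define A where "A i j \<zeta> = K \<zeta> $ i $ j * dpsi_DE a b \<zeta>" for i j \<zeta>
  define h where "h i \<zeta> = g \<zeta> $ i * dpsi_DE a b \<zeta>" for i \<zeta>
  \<comment> \<open>\<open>W\<close> keeps the rate of each horizontal line, as membership in
    \<open>M_space\<close> requires. The rate \<kappa> at the edge of the strip gives the uniform
    bound for the Picard iteration and for the arguments on the interval.\<close>
  define W where "W \<zeta> = weight (\<alpha> * pi * cos (Im \<zeta>)) (Re \<zeta>)" for \<zeta>
  define \<kappa> where "\<kappa> = \<alpha> * pi * cos d"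
  define N where "N = real CARD('n)"
  have N: "0 < N" by (simp add: N_def)
  have "0 < cos d" using d by (intro cos_gt_zero) auto
  then have \<kappa>: "0 < \<kappa>" using \<alpha> by (simp add: \<kappa>_def)
  have W: "0 < W \<zeta>" for \<zeta> by (simp add: W_def)
  have W_le: "W \<zeta> \<le> weight \<kappa> (Re \<zeta>)" if "\<zeta> \<in> strip d" for \<zeta>
    unfolding W_def using that cos_strip(2)[OF d(2), of "Im \<zeta>"] \<kappa> \<alpha>
    by (intro weight_antimono) (auto simp: \<kappa>_def strip_def)
  have A_hol: "A i j holomorphic_on strip d" for i j
    unfolding A_def using L_space_times_dpsi_DE(1)[OF ab d \<alpha> assms(6)] .
  have h_hol: "h i holomorphic_on strip d" for i
    unfolding h_def using L_space_times_dpsi_DE(1)[OF ab d \<alpha> assms(7)] .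
  have "\<exists>L. \<forall>\<zeta>\<in>strip d. norm (A i j \<zeta>) \<le> L * W \<zeta>" for i j
    unfolding A_def W_def using L_space_times_dpsi_DE(2)[OF ab d \<alpha> assms(6)] .
  then obtain LA where LA: "\<And>i j \<zeta>. \<zeta> \<in> strip d \<Longrightarrow> norm (A i j \<zeta>) \<le> LA i j * W \<zeta>"
    by metis
  have "\<exists>L. \<forall>\<zeta>\<in>strip d. norm (h i \<zeta>) \<le> L * W \<zeta>" for i
    unfolding h_def W_def using L_space_times_dpsi_DE(2)[OF ab d \<alpha> assms(7)] .
  then obtain Lh where Lh: "\<And>i \<zeta>. \<zeta> \<in> strip d \<Longrightarrow> norm (h i \<zeta>) \<le> Lh i * W \<zeta>"
    by metis
  \<comment> \<open>One constant for all entries; the element 1 makes it positive.\<close>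
  define L where "L = Max (insert 1 (range (\<lambda>(i, j). LA i j) \<union> range Lh))"
  have L: "0 < L"
    unfolding L_def by (rule less_le_trans[OF zero_less_one Max_ge]) auto
  have LA_le: "LA i j \<le> L" for i j
    unfolding L_def by (intro Max_ge) (auto intro: image_eqI[of _ _ "(i, j)"])
  have A_le: "norm (A i j \<zeta>) \<le> L * W \<zeta>" if "\<zeta> \<in> strip d" for i j \<zeta>
    using order_trans[OF LA[OF that] mult_right_mono[OF LA_le less_imp_le[OF W]]] .
  have Lh_le: "Lh i \<le> L" for i
    unfolding L_def by (intro Max_ge) auto
  have h_le: "norm (h i \<zeta>) \<le> L * W \<zeta>" if "\<zeta> \<in> strip d" for i \<zeta>
    using order_trans[OF Lh[OF that] mult_right_mono[OF Lh_le less_imp_le[OF W]]] .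
  have LW: "L * W \<zeta> \<le> L * weight \<kappa> (Re \<zeta>)" if "\<zeta> \<in> strip d" for \<zeta>
    using L W_le[OF that] by simp

  \<comment> \<open>Solution on the strip and its boundary behaviour\<close>
  obtain Y where Y: "\<And>i \<zeta>. \<zeta> \<in> strip d \<Longrightarrow>
      (Y i has_field_derivative (\<Sum>j\<in>UNIV. A i j \<zeta> * Y j \<zeta>) + h i \<zeta>) (at \<zeta>)"
    and Y_left: "\<And>i. (Y i \<longlongrightarrow> r $ i) (left_end d)"
    and Y_bdd: "\<And>i. bounded (Y i ` strip d)"
    using linear_system_on_strip[where A = A and h = h and r = "\<lambda>i. r $ i",
          OF A_hol h_hol d(1) \<kappa> L order_trans[OF A_le LW] order_trans[OF h_le LW]]
    by blast
  define f where "f i \<zeta> = (\<Sum>j\<in>UNIV. A i j \<zeta> * Y j \<zeta>) + h i \<zeta>" for i \<zeta>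
  have "bounded (\<Union>i. Y i ` strip d)"
    using Y_bdd by (intro bounded_UN) auto
  then obtain B where "0 < B" and "\<forall>x\<in>(\<Union>i. Y i ` strip d). norm x \<le> B"
    unfolding bounded_pos by blast
  then have B: "0 \<le> B" "\<And>i \<zeta>. \<zeta> \<in> strip d \<Longrightarrow> norm (Y i \<zeta>) \<le> B"
    by auto
  define C where "C = N * (L * B) + L"
  have C: "0 < C" using N L B by (simp add: C_def add_nonneg_pos)
  have f_le: "norm (f i \<zeta>) \<le> C * W \<zeta>" if \<zeta>: "\<zeta> \<in> strip d" for i \<zeta>
  proof -
    have "norm (\<Sum>j\<in>UNIV. A i j \<zeta> * Y j \<zeta>) \<le> (\<Sum>j\<in>(UNIV::'n set). (L * W \<zeta>) * B)"
      unfolding norm_mult using A_le[OF \<zeta>] B \<zeta> L W[of \<zeta>]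
      by (intro sum_norm_le) (auto simp: norm_mult intro!: mult_mono)
    also have "\<dots> = N * (L * B) * W \<zeta>" by (simp add: N_def)
    finally show ?thesis
      unfolding f_def C_def using h_le[OF \<zeta>, of i]
      by (intro norm_triangle_le) (simp add: algebra_simps)
  qed
  have Y_M: "Y i \<in> M_space a b d \<alpha>" for i
    using M_space_of_derivative_bound[OF ab d \<alpha> Y, of i C] f_le by (simp add: f_def W_def)
  then have "\<exists>m. (Y i \<longlongrightarrow> m) (right_end d)" for i
    by (auto simp: M_space_def)
  then obtain m where Y_right: "\<And>i. (Y i \<longlongrightarrow> m i) (right_end d)"
    by metis

  \<comment> \<open>Transfer to the interval\<close>
  define u where "u x = (\<chi> i. Y i (of_real x))" for x
  define u' where "u' x = (\<chi> i. f i (of_real x))" for x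
  have u: "(u has_vector_derivative u' x) (at x)" for x
    unfolding u_def [abs_def] u'_def
  proof (rule has_vector_derivative_vec_lambda)
    show "((\<lambda>x. Y i (of_real x)) has_vector_derivative f i (of_real x)) (at x)" for i
      using has_vector_derivative_Complex_line[where y = 0, OF Y] d
      by (simp add: f_def flip: complex_of_real_def)
  qed
  have left: "filterlim of_real (left_end d) at_bot"
    using filterlim_Complex_left_end[of 0 d] d by (simp add: complex_of_real_def [abs_def])
  have right: "filterlim of_real (right_end d) at_top"
    using filterlim_Complex_right_end[of 0 d] d by (simp add: complex_of_real_def [abs_def])
  have u_left: "(u \<longlongrightarrow> r) at_bot"
    unfolding u_def [abs_def]
    by (rule vec_tendstoI) (simp add: filterlim_compose[OF Y_left left])
  have u_right: "(u \<longlongrightarrow> (\<chi> i. m i)) at_top"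
    unfolding u_def [abs_def] by (intro tendsto_vec_lambda filterlim_compose[OF Y_right right])
  let ?x = "inv_psi_DE a b"
  let ?D = "\<lambda>t. real_dpsi_DE a b (?x t)"
  have D: "0 < ?D t" for t using real_dpsi_DE_pos[OF ab] .
  have dpsi: "dpsi_DE a b (of_real (?x t)) = of_real (?D t)" for t
    using dpsi_DE_of_real[OF ab] .
  let ?k = "\<lambda>t. on_interval a b K t"
  let ?g = "\<lambda>t. on_interval a b g t"
  obtain y where y_cont: "continuous_on {a..b} y" and y_ends: "y a = r" "y b = (\<chi> i. m i)"
    and y_int: "\<And>t. a < t \<Longrightarrow> t < b \<Longrightarrow> y t = u (?x t)"
    and y_deriv: "\<And>t. a < t \<Longrightarrow> t < b \<Longrightarrow> (y has_vector_derivative u' (?x t) /\<^sub>R ?D t) (at t)"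
    using interval_extension[OF ab u u_left u_right] by blast
  \<comment> \<open>On the real axis \<open>dpsi_DE\<close> is the positive real factor
    \<open>?D t\<close>, so the equation on the strip is \<open>?D t\<close> times the original
    one.\<close>
  have y': "u' (?x t) /\<^sub>R ?D t = ?g t + ?k t *v y t" if "a < t" "t < b" for t
  proof -
    have "u' (?x t) = ?D t *\<^sub>R (?g t + ?k t *v y t)"
      unfolding vec_eq_iff vector_scaleR_component using that
      by (simp add: u'_def f_def A_def h_def dpsi y_int u_def on_interval_eq matrix_vector_mult_def
          scaleR_conv_of_real sum_distrib_left algebra_simps)
    then show ?thesis using D[of t] by simp
  qed
  have weight_deriv: "(weight_prim \<kappa> has_vector_derivative weight \<kappa> x) (at x)" for x
    using DERIV_weight_prim[of \<kappa>] \<kappa> by (simp add: has_real_derivative_iff_has_vector_derivative)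
  \<comment> \<open>\<open>H\<close> is continuous on the closed interval, although its derivative
    may be singular at the end points.\<close>
  obtain H where H_cont: "continuous_on {a..b} H"
    and H_deriv: "\<And>t. a < t \<Longrightarrow> t < b \<Longrightarrow>
      (H has_vector_derivative weight \<kappa> (?x t) /\<^sub>R ?D t) (at t)"
  proof (rule interval_extension[OF ab weight_deriv weight_prim_at_bot[OF \<kappa>] weight_prim_at_top[OF \<kappa>]])
    fix v
    assume "continuous_on {a..b} v"
      and "\<And>t. a < t \<Longrightarrow> t < b \<Longrightarrow> (v has_vector_derivative weight \<kappa> (?x t) /\<^sub>R ?D t) (at t)"
    then show thesis by (rule that)
  qed
  have on_real: "L' * W (of_real x) \<le> L' * weight \<kappa> x" if "0 < L'" for x L'
    using W_le[of "of_real x"] d that by simp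

  \<comment> \<open>Existence\<close>
  define F where "F s = ?g s + ?k s *v y s" for s
  have F_int: "(F has_integral y t - r) {a..t}" if "t \<in> {a..b}" for t
    unfolding y_ends(1)[symmetric]
    using that y_deriv y'
    by (intro fundamental_theorem_of_calculus_interior continuous_on_subset[OF y_cont])
       (auto simp: F_def)
  have "F absolutely_integrable_on {a..b}"
  proof (rule absolutely_integrable_integrable_bound)
    \<comment> \<open>Each of the N components of \<open>u'\<close> is bounded by C times the
      weight, which gives \<open>N * C\<close>. At the end points, where \<open>on_interval\<close>
      is unspecified, \<open>norm (F s)\<close> bounds itself.\<close>
    define G where "G s = (if a < s \<and> s < b then (N * C) *\<^sub>R (weight \<kappa> (?x s) /\<^sub>R ?D s) else norm (F s))" for s
    show "norm (F s) \<le> G s" if "s \<in> {a..b}" for s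
    proof (cases "a < s \<and> s < b")
      case True
      have "norm (u' (?x s)) \<le> (\<Sum>i\<in>(UNIV::'n set). C * weight \<kappa> (?x s))"
        using order_trans[OF f_le on_real[OF C]] d
        by (intro order_trans[OF norm_vec_le_sum] sum_mono) (auto simp: u'_def)
      then have "norm (u' (?x s) /\<^sub>R ?D s) \<le> N * (C * weight \<kappa> (?x s)) / ?D s"
        using D[of s] by (simp add: N_def divide_simps)
      then show ?thesis
        using True y' by (simp add: G_def F_def divide_inverse mult_ac)
    qed (auto simp: G_def)
    have "(G has_integral (N * C) *\<^sub>R H b - (N * C) *\<^sub>R H a) {a..b}"
    proof (rule fundamental_theorem_of_calculus_interior)
      show "continuous_on {a..b} (\<lambda>s. (N * C) *\<^sub>R H s)"
        by (intro continuous_intros H_cont)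
      show "((\<lambda>s. (N * C) *\<^sub>R H s) has_vector_derivative G s) (at s)" if "s \<in> {a<..<b}" for s
        using bounded_linear.has_vector_derivative[OF bounded_linear_scaleR_right H_deriv[of s], of "N * C"] that
        by (simp add: G_def)
    qed (use ab in simp)
    then show "G integrable_on {a..b}" by blast
    show "F integrable_on {a..b}" using F_int[of b] ab by auto
  qed
  then have sol: "ivp_solution a b K g r y"
    unfolding ivp_solution_def F_def [abs_def, symmetric]
    using y_cont F_int[THEN integral_unique] by simp

  \<comment> \<open>Uniqueness\<close>
  have "z t = y t" if z: "ivp_solution a b K g r z" and t: "t \<in> {a..b}" for z t
  proof -
    define Fz where "Fz s = ?g s + ?k s *v z s" for s
    have z': "continuous_on {a..b} z" "Fz integrable_on {a..b}"
      "\<And>t. t \<in> {a..b} \<Longrightarrow> z t = r + integral {a..t} Fz"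
      using z unfolding ivp_solution_def Fz_def [abs_def, symmetric]
      by (auto simp: absolutely_integrable_on_def)
    \<comment> \<open>The matrix norm is estimated by the sum over its N * N entries.\<close>
    define c where "c = N * N * L"
    have c: "0 < c" using N L by (simp add: c_def)
    have "z t - y t = 0"
    proof (rule integral_eq_zero_of_Gronwall[where f = "\<lambda>s. Fz s - F s" and H = "\<lambda>s. c * H s"
          and H' = "\<lambda>s. c * (weight \<kappa> (?x s) / ?D s)", OF ab])
      show "continuous_on {a..b} (\<lambda>t. z t - y t)" "continuous_on {a..b} (\<lambda>s. c * H s)"
        by (intro continuous_intros z' y_cont H_cont)+
      show "(\<lambda>s. Fz s - F s) integrable_on {a..b}"
        using F_int[of b] ab z' by (intro integrable_diff) auto
      show "z t - y t = integral {a..t} (\<lambda>s. Fz s - F s)" if t: "t \<in> {a..b}" for t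
      proof -
        have "Fz integrable_on {a..t}"
          by (rule integrable_on_subinterval[OF z'(2)]) (use t in auto)
        then show ?thesis
          using F_int[OF t] z'(3)[OF t] by (subst integral_diff) (auto dest: integral_unique)
      qed
      show "((\<lambda>s. c * H s) has_real_derivative c * (weight \<kappa> (?x t) / ?D t)) (at t)"
        if "a < t" "t < b" for t
        using H_deriv[OF that] unfolding has_real_derivative_iff_has_vector_derivative[symmetric]
        by (auto intro!: derivative_eq_intros simp: divide_inverse mult_ac)
      show "0 \<le> c * (weight \<kappa> (?x t) / ?D t)" for t
        using c D[of t] by simp
      show "norm (Fz t - F t) \<le> c * (weight \<kappa> (?x t) / ?D t) * norm (z t - y t)"
        if t: "a < t" "t < b" for t
      proof -
        have "norm (?k t $ i $ j) \<le> L * weight \<kappa> (?x t) / ?D t" for i j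
        proof -
          have "norm (A i j (of_real (?x t))) \<le> L * weight \<kappa> (?x t)"
            using order_trans[OF A_le on_real[OF L]] d by simp
          then show ?thesis
            using D[of t] t by (simp add: A_def dpsi norm_mult on_interval_eq field_simps)
        qed
        then have "(\<Sum>i\<in>UNIV. \<Sum>j\<in>UNIV. norm (?k t $ i $ j))
            \<le> (\<Sum>i\<in>(UNIV::'n set). \<Sum>j\<in>(UNIV::'n set). L * weight \<kappa> (?x t) / ?D t)"
          by (intro sum_mono)
        also have "\<dots> = c * (weight \<kappa> (?x t) / ?D t)"
          by (simp add: c_def N_def)
        finally have "norm (?k t *v (z t - y t)) \<le> c * (weight \<kappa> (?x t) / ?D t) * norm (z t - y t)"
          by (intro order_trans[OF norm_matrix_vector_mult_le] mult_right_mono) auto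
        moreover have "Fz t - F t = ?k t *v (z t - y t)"
          by (simp add: Fz_def F_def matrix_vector_mult_diff_distrib)
        ultimately show ?thesis by simp
      qed
    qed (rule t)
    then show ?thesis by simp
  qed
  \<comment> \<open>The analytic extension is \<open>Y i\<close>, whose limits at the two ends are
    the values of \<open>y\<close> at \<open>a\<close> and \<open>b\<close>.\<close>
  moreover have "(\<lambda>t. y t $ i) \<in> interval_M_space a b d \<alpha>" for i
    unfolding interval_M_space_def using Y_M[of i] Y_left[of i] Y_right[of i]
    by (auto intro!: bexI[of _ "Y i"] simp: y_ends y_int on_interval_eq u_def)
  ultimately show ?thesis
    using sol by blast
qed

end
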